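(* Let $2\le k\le n-2$ and let $\pi(\mathbf{c})=\sum_J c_Je^J\in\mathbb{R}^{\binom{n}{k}}$. Then $\pi(\mathbf{c})$ satisfies the positive tropical Plücker relations $$c_{Lj_1j_3}+c_{Lj_2j_4}=\max\left\{c_{Lj_1j_2}+c_{Lj_3j_4},\ c_{Lj_1j_4}+c_{Lj_2j_3}\right\}$$ for every $j_1<j_2<j_3<j_4$ in cyclic order and every $L\in\binom{[n]\setminus\{j_1,j_2,j_3,j_4\}}{k-2}$ (i.e. for every octahedral face of $\Delta_{k,n}$, with six vertices $e_{Lj_aj_b}$) if and only if the weighted blade arrangement $\beta(\mathbf{c})=\sum_Jc_J\mathcal{L}_J\in\mathfrak{B}_{k,n}$ lies in $\mathcal{Z}_{k,n}$. Moreover, the linear map $\mathbb{R}^{\binom{n}{k}}\to\mathfrak{B}_{k,n}$, $e^J\mapsto\mathcal{L}_J$, induces, after passing to the quotient of $\mathbb{R}^{\binom{n}{k}}$ by the lineality space $\text{span}\{\sum_{J\ni a}e^J: a=1,\ldots,n\}$, a bijection between the image of the positive tropical Grassmannian $\text{Trop}_+G(k,n)$ and $\mathcal{Z}_{k,n}$.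
   Context: Write $[n]=\{1,\ldots,n\}$ with the standard cyclic order $(1,2,\ldots,n)$, indices modulo $n$; $\{e^J: J\in\binom{[n]}{k}\}$ is the standard basis of $\mathbb{R}^{\binom{n}{k}}$; $\Delta_{k,n}=\{x\in[0,1]^n:\sum x_i=k\}$, with vertices $e_J=\sum_{j\in J}e_j$; $Lab$ means $L\cup\{a,b\}$. Blade spaces. For $L\subset[n]$, the set $[n]\setminus L$ carries the inherited ("gapped") cyclic order. A subset $J\subseteq[n]\setminus L$ is frozen if it is a cyclic interval (a set of consecutive elements) for this cyclic order, and nonfrozen otherwise. $\mathfrak{B}^{(L)}_{k,n}$ is the real vector space with basis the formal symbols $\beta^{(L)}_J$, where $J$ ranges over the nonfrozen $(k-|L|)$-element subsets of $[n]\setminus L$; one sets $\beta^{(L)}_J=0$ if $J$ is frozen. For $L=\emptyset$ write $\beta_J$ and $\mathfrak{B}_{k,n}$. Boundary operators. $\partial_j$ is the linear operator with $\partial_j(\beta^{(L)}_J)=0$ if $j\in L$, and $\partial_j(\beta^{(L)}_J)=\beta^{(L\cup\{j\})}_{J\setminus\{\ell\}}$ if $j\notin L$, where $\ell=j$ if $j\in J$, and otherwise $\ell$ is the cyclically next element after $j$ that lies in $J$. For $L=\{\ell_1<\cdots<\ell_d\}$, $\partial_L=\partial_{\ell_1}\cdots\partial_{\ell_d}$. Elements $\mathcal{L}_J$. For $J\in\binom{[n]}{k}$ let $j_1,\ldots,j_t$ be the cyclic initial points of the (maximal) cyclic intervals of $J$. For $M=(m_1,\ldots,m_t)\in\{0,1\}^t$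 let $J_M$ be obtained from $J$ by replacing each $j_a$ by $j_a-m_a$ (mod $n$). Then $\mathcal{L}_J=\sum_{M\in\{0,1\}^t}(-1)^{1+M\cdot M}\beta_{J_M}\in\mathfrak{B}_{k,n}$, where $M\cdot M$ is the number of ones in $M$. The set $\mathcal{Z}_{k,n}$. $\mathcal{Z}_{k,n}\subset\mathfrak{B}_{k,n}$ is the set of all $\beta\in\mathfrak{B}_{k,n}$ such that for every $L\in\binom{[n]}{k-2}$, expanding $\partial_L(\beta)=\sum\omega^{(L)}_{ij}\beta^{(L)}_{ij}$ over nonfrozen pairs $\{i,j\}\subset[n]\setminus L$: (1) all $\omega^{(L)}_{ij}\ge0$; and (2) the support $\{\beta^{(L)}_{ij}:\omega^{(L)}_{ij}\ne0\}$ is a matroidal blade arrangement, i.e. the pairs $\{i,j\}$ in the support are pairwise weakly separated with respect to the cyclic order on $[n]\setminus L$. Two pairs $\{i,j\},\{a,b\}$ fail to be weakly separated exactly when they are disjoint and cross (i.e. $i<a<j<b$ up to cyclic rotation and exchanging $a$ and $b$). Positive tropical Grassmannian. $\text{Trop}_+G(k,n)$ is the set of all positive tropical Plücker vectors, i.e. all points of $\mathbb{R}^{\binom{n}{k}}$ satisfying all the positive tropical Plücker relations displayed in the claim (max convention).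
   Formalization: The sign in L_J is corrected from (-1)^{1+M·M} to (-1)^{M·M}; with the printed sign and the max convention the claim fails, e.g. for k=2, n=4, c_12=c_13=1 and all other c_J=0, where the relation holds but β(c) = −β_13 is not in Z. *)

theory Defs
  imports Complex_Main
begin

text \<open>
  Throughout, \<open>[n]\<close> is \<open>{1..n}\<close> with the cyclic order \<open>1, 2, \<dots>, n, 1, \<dots>\<close>.  Vectors in a
  real vector space with a basis indexed by subsets of \<open>[n]\<close> are functions \<open>nat set \<Rightarrow> real\<close>
  that vanish outside the index set.
\<close>

section \<open>Cyclic order\<close>

definition cyclically_ordered :: "nat list \<Rightarrow> bool" where
  "cyclically_ordered xs \<longleftrightarrow> (\<exists>r. sorted_wrt (<) (rotate r xs))"

text \<open>The cyclic order that \<open>S\<close> inherits from \<open>[n]\<close> is that of its increasing listing, read cyclically.\<close>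

definition cyclic_interval :: "nat set \<Rightarrow> nat set \<Rightarrow> bool" where
  "cyclic_interval S J \<longleftrightarrow> (\<exists>r m. J = set (take m (rotate r (sorted_list_of_set S))))"

definition cyclic_pred :: "nat \<Rightarrow> nat \<Rightarrow> nat" where
  "cyclic_pred n j = (if j = 1 then n else j - 1)"

text \<open>The number of steps from \<open>a\<close> forward to \<open>b\<close>, for \<open>a, b \<in> [n]\<close>.\<close>

definition cyclic_dist :: "nat \<Rightarrow> nat \<Rightarrow> nat \<Rightarrow> nat" where
  "cyclic_dist n a b = (b + n - a) mod n"

definition next_elem :: "nat \<Rightarrow> nat set \<Rightarrow> nat \<Rightarrow> nat" where
  "next_elem n J j = (if j \<in> J then j else arg_min_on (cyclic_dist n j) J)"

section \<open>Blade spaces and boundary operators\<close>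

definition frozen :: "nat \<Rightarrow> nat set \<Rightarrow> nat set \<Rightarrow> bool" where
  "frozen n L J \<longleftrightarrow> cyclic_interval ({1..n} - L) J"

definition blade_index :: "nat \<Rightarrow> nat \<Rightarrow> nat set \<Rightarrow> nat set set" where
  "blade_index n k L = {J. J \<subseteq> {1..n} - L \<and> card J + card L = k \<and> \<not> frozen n L J}"

definition blade_space :: "nat \<Rightarrow> nat \<Rightarrow> nat set \<Rightarrow> (nat set \<Rightarrow> real) set" where
  "blade_space n k L = {f. \<forall>J. J \<notin> blade_index n k L \<longrightarrow> f J = 0}"

definition blade :: "nat \<Rightarrow> nat set \<Rightarrow> nat set \<Rightarrow> (nat set \<Rightarrow> real)" where
  "blade n L J = (\<lambda>K. if K = J \<and> \<not> frozen n L J then 1 else 0)"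

text \<open>
  The operator \<open>\<partial>\<^sub>j\<close> on the blade space for \<open>L\<close>, with values in the one for \<open>insert j L\<close>:
  the linear extension of its values on the basis.
\<close>

definition boundary :: "nat \<Rightarrow> nat \<Rightarrow> nat set \<Rightarrow> nat \<Rightarrow> (nat set \<Rightarrow> real) \<Rightarrow> (nat set \<Rightarrow> real)" where
  "boundary n k L j f =
     (if j \<in> L then (\<lambda>_. 0)
      else (\<lambda>K. \<Sum>J\<in>blade_index n k L. f J * blade n (insert j L) (J - {next_elem n J j}) K))"

fun boundary_list :: "nat \<Rightarrow> nat \<Rightarrow> nat list \<Rightarrow> (nat set \<Rightarrow> real) \<Rightarrow> (nat set \<Rightarrow> real)" where
  "boundary_list n k [] f = f"
| "boundary_list n k (l # ls) f = boundary n k (set ls) l (boundary_list n k ls f)"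

definition boundary_set :: "nat \<Rightarrow> nat \<Rightarrow> nat set \<Rightarrow> (nat set \<Rightarrow> real) \<Rightarrow> (nat set \<Rightarrow> real)" where
  "boundary_set n k L f = boundary_list n k (sorted_list_of_set L) f"

section \<open>The elements \<open>\<L>\<^sub>J\<close> and the weighted blade arrangement \<open>\<beta>(c)\<close>\<close>

definition initial_points :: "nat \<Rightarrow> nat set \<Rightarrow> nat set" where
  "initial_points n J = {j \<in> J. cyclic_pred n j \<notin> J}"

text \<open>
  A vector \<open>M \<in> {0,1}\<^sup>t\<close> is encoded as the set \<open>M\<close> of those initial points where its entry
  is 1, so that \<open>M \<cdot> M = card M\<close>.
\<close>

definition shifted :: "nat \<Rightarrow> nat set \<Rightarrow> nat set \<Rightarrow> nat set" where
  "shifted n J M = (\<lambda>j. if j \<in> M then cyclic_pred n j else j) ` J"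

text \<open>
  Sign convention.  This is the negative of the element as usually printed, which carries the
  sign \<open>(-1)\<^bsup>1 + M \<cdot> M\<^esup>\<close>.  The printed sign fits the min convention for the tropical Pluecker
  relations, and with the max convention of \<open>positive_pluecker\<close> below the equivalence with
  membership in \<open>Z_set\<close> fails for it:
  for \<open>k = 2\<close>, \<open>n = 4\<close>, with the sign used here,
    \<open>\<beta>(c) = (c\<^sub>1\<^sub>3 + c\<^sub>2\<^sub>4 - c\<^sub>1\<^sub>4 - c\<^sub>2\<^sub>3) \<beta>\<^sub>1\<^sub>3 + (c\<^sub>1\<^sub>3 + c\<^sub>2\<^sub>4 - c\<^sub>1\<^sub>2 - c\<^sub>3\<^sub>4) \<beta>\<^sub>2\<^sub>4\<close>,
  and its coefficients are nonnegative and not both positive exactly when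
    \<open>c\<^sub>1\<^sub>3 + c\<^sub>2\<^sub>4 = max (c\<^sub>1\<^sub>2 + c\<^sub>3\<^sub>4) (c\<^sub>1\<^sub>4 + c\<^sub>2\<^sub>3)\<close>.
\<close>

definition L_elem :: "nat \<Rightarrow> nat set \<Rightarrow> (nat set \<Rightarrow> real)" where
  "L_elem n J = (\<lambda>K. \<Sum>M\<in>Pow (initial_points n J). (-1) ^ card M * blade n {} (shifted n J M) K)"

definition k_subsets :: "nat \<Rightarrow> nat \<Rightarrow> nat set set" where
  "k_subsets n k = {J. J \<subseteq> {1..n} \<and> card J = k}"

definition pluecker_space :: "nat \<Rightarrow> nat \<Rightarrow> (nat set \<Rightarrow> real) set" where
  "pluecker_space n k = {c. \<forall>J. J \<notin> k_subsets n k \<longrightarrow> c J = 0}"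

definition blade_arrangement :: "nat \<Rightarrow> nat \<Rightarrow> (nat set \<Rightarrow> real) \<Rightarrow> (nat set \<Rightarrow> real)" where
  "blade_arrangement n k c = (\<lambda>K. \<Sum>J\<in>k_subsets n k. c J * L_elem n J K)"

section \<open>The set \<open>\<Z>\<close>\<close>

definition crossing :: "nat set \<Rightarrow> nat set \<Rightarrow> bool" where
  "crossing I A \<longleftrightarrow> (\<exists>i j a b. I = {i, j} \<and> A = {a, b} \<and> cyclically_ordered [i, a, j, b])"

definition weakly_separated :: "nat set \<Rightarrow> nat set \<Rightarrow> bool" where
  "weakly_separated I A \<longleftrightarrow> \<not> crossing I A"

definition Z_set :: "nat \<Rightarrow> nat \<Rightarrow> (nat set \<Rightarrow> real) set" where
  "Z_set n k = {\<beta> \<in> blade_space n k {}.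
     \<forall>L\<in>k_subsets n (k - 2).
       (\<forall>I\<in>blade_index n k L. boundary_set n k L \<beta> I \<ge> 0) \<and>
       (\<forall>I\<in>blade_index n k L. \<forall>A\<in>blade_index n k L.
          boundary_set n k L \<beta> I \<noteq> 0 \<longrightarrow> boundary_set n k L \<beta> A \<noteq> 0 \<longrightarrow> weakly_separated I A)}"

section \<open>Positive tropical Pluecker vectors and the lineality space\<close>

definition positive_pluecker :: "nat \<Rightarrow> nat \<Rightarrow> (nat set \<Rightarrow> real) \<Rightarrow> bool" where
  "positive_pluecker n k c \<longleftrightarrow>
     (\<forall>j1 j2 j3 j4 L. {j1, j2, j3, j4} \<subseteq> {1..n} \<longrightarrow> cyclically_ordered [j1, j2, j3, j4] \<longrightarrow>
        L \<subseteq> {1..n} - {j1, j2, j3, j4} \<longrightarrow> card L = k - 2 \<longrightarrow>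
        c (L \<union> {j1, j3}) + c (L \<union> {j2, j4}) =
          max (c (L \<union> {j1, j2}) + c (L \<union> {j3, j4})) (c (L \<union> {j1, j4}) + c (L \<union> {j2, j3})))"

definition trop_plus :: "nat \<Rightarrow> nat \<Rightarrow> (nat set \<Rightarrow> real) set" where
  "trop_plus n k = {c \<in> pluecker_space n k. positive_pluecker n k c}"

definition lineality_gen :: "nat \<Rightarrow> nat \<Rightarrow> nat \<Rightarrow> (nat set \<Rightarrow> real)" where
  "lineality_gen n k a = (\<lambda>J. if J \<in> k_subsets n k \<and> a \<in> J then 1 else 0)"

definition lineality :: "nat \<Rightarrow> nat \<Rightarrow> (nat set \<Rightarrow> real) set" where
  "lineality n k = {v. \<exists>t. v = (\<lambda>J. \<Sum>a\<in>{1..n}. t a * lineality_gen n k a J)}"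

definition lineality_rel :: "nat \<Rightarrow> nat \<Rightarrow> ((nat set \<Rightarrow> real) \<times> (nat set \<Rightarrow> real)) set" where
  "lineality_rel n k = {(c, d). c \<in> pluecker_space n k \<and> d \<in> pluecker_space n k \<and>
                               (\<lambda>J. c J - d J) \<in> lineality n k}"

definition lineality_class :: "nat \<Rightarrow> nat \<Rightarrow> (nat set \<Rightarrow> real) \<Rightarrow> (nat set \<Rightarrow> real) set" where
  "lineality_class n k c = lineality_rel n k `` {c}"

end

theory Submission
  imports Defs
begin

text \<open>
  Write \<open>\<beta>(c)\<close> for the weighted blade arrangement of \<open>c\<close>.  Both halves of the proof are
  computations with alternating sums over subsets, whose terms cancel in pairs as soon as the
  summand does not depend on one of the points.

  \<^bold>\<open>Membership.\<close>  Let \<open>S\<close> be the set \<open>{1..n}\<close> with the points of \<open>L\<close> removed, in its gapped cyclic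
  order.  For every \<open>L\<close> there are elements \<open>\<L>\<^sub>J\<close> built from the cyclic order of \<open>S\<close>, and
  \<open>\<partial>\<^sub>j\<close> sends \<open>\<L>\<^sub>J\<close> to \<open>\<L>\<^bsub>J - j\<^esub>\<close> if \<open>j \<in> J\<close> and to \<open>0\<close> otherwise, as long as \<open>J\<close> has at
  least two elements (\<open>boundary_gapped_L_elem_in\<close>, \<open>boundary_gapped_L_elem_notin\<close>).  So \<open>\<partial>\<^sub>L \<beta>(c)\<close> is the same kind of
  arrangement on \<open>S\<close>, with weights \<open>c\<^bsub>LJ\<^esub>\<close>.  When \<open>L\<close> has \<open>k - 2\<close> elements, its coefficient at
  a nonfrozen pair \<open>{i, j}\<close> is the second difference
    \<open>\<omega>\<^sub>i\<^sub>j = c\<^bsub>Lij\<^esub> + c\<^bsub>Li'j'\<^esub> - c\<^bsub>Li'j\<^esub> - c\<^bsub>Lij'\<^esub>\<close>,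
  where primes denote successors in \<open>S\<close>.  Second differences telescope: for \<open>j\<^sub>1, j\<^sub>2, j\<^sub>3, j\<^sub>4\<close> in
  cyclic order,
    \<open>c\<^sub>1\<^sub>3 + c\<^sub>2\<^sub>4 - c\<^sub>1\<^sub>4 - c\<^sub>2\<^sub>3\<close> is the sum of \<open>\<omega>\<close> over the rectangle \<open>[j\<^sub>1, j\<^sub>2) \<times> [j\<^sub>3, j\<^sub>4)\<close>, and
    \<open>c\<^sub>1\<^sub>3 + c\<^sub>2\<^sub>4 - c\<^sub>1\<^sub>2 - c\<^sub>3\<^sub>4\<close> is the sum of \<open>\<omega>\<close> over \<open>[j\<^sub>2, j\<^sub>3) \<times> [j\<^sub>4, j\<^sub>1)\<close>.
  The Pluecker relation says that the smaller of the two sums is \<open>0\<close>, and any pair from the first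
  rectangle crosses any pair from the second.  This is why nonnegativity of all \<open>\<omega>\<close> together with
  absence of crossings in the support is equivalent to all the Pluecker relations for \<open>L\<close>
  (\<open>pluecker_iff_second_differences\<close>).

  \<^bold>\<open>Bijection.\<close>  The map \<open>c \<mapsto> \<beta>(c)\<close> is onto the blade space, and its kernel is the lineality
  space; the lineality space is killed because membership of a given \<open>a\<close> in a shifted set
  depends on one point only, and the rest comes from an explicit inverse.  Read \<open>J\<close> as a lattice
  path with heights \<open>|J \<inter> {1..j}|\<close>, and put
    \<open>\<rho>\<^sub>K(J) = min\<^sub>j (|J \<inter> {1..j}| - |K \<inter> {1..j}|)\<close>.
  Up to a constant, moving a point of \<open>J\<close> one step forward lowers the path at a single place.  If
  at least two points can move, the constants cancel, and the alternating sum of \<open>\<rho>\<^sub>K\<close> over all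
  combinations of such moves is \<open>1\<close> if all the places involved are minima of the difference of the
  two paths, and \<open>0\<close> otherwise (\<open>alternating_sum_Min\<close>).  For the places at the ends of the cyclic
  intervals of \<open>J\<close> this forces \<open>J = K\<close> (\<open>eq_if_terminals_minimal\<close>).  Hence \<open>\<beta>(\<rho>\<^sub>K) = \<beta>\<^sub>K\<close>.  The mirror
  image of this argument, in which \<open>K\<close> moves backwards, shows that \<open>c - \<Sum>\<^sub>K \<beta>(c)\<^sub>K \<rho>\<^sub>K\<close> lies in the
  lineality space; there the frozen \<open>K\<close> contribute only lineality, because for them the minimum is
  attained at the same place for all \<open>J\<close> (\<open>minimal_at_unique_terminal\<close>).
\<close>

section \<open>Alternating sums over subsets\<close>

lemma alternating_sum_Pow_insert:
  fixes h :: "'a set \<Rightarrow> real"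
  assumes "finite A" "x \<notin> A"
  shows "(\<Sum>M\<in>Pow (insert x A). (-1) ^ card M * h M)
       = (\<Sum>M\<in>Pow A. (-1) ^ card M * (h M - h (insert x M)))"
proof -
  have inj: "inj_on (insert x) (Pow A)"
    using assms(2) by (auto simp: inj_on_def)
  have disj: "Pow A \<inter> insert x ` Pow A = {}"
    using assms(2) by auto
  have "(\<Sum>M\<in>Pow (insert x A). (-1) ^ card M * h M)
      = (\<Sum>M\<in>Pow A. (-1) ^ card M * h M) + (\<Sum>M\<in>insert x ` Pow A. (-1) ^ card M * h M)"
    unfolding Pow_insert using assms(1) disj by (intro sum.union_disjoint) auto
  also have "(\<Sum>M\<in>insert x ` Pow A. (-1) ^ card M * h M)
           = (\<Sum>M\<in>Pow A. - ((-1) ^ card M * h (insert x M)))"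
    unfolding sum.reindex[OF inj] comp_def
  proof (rule sum.cong)
    fix M assume "M \<in> Pow A"
    then have "finite M" "x \<notin> M" using assms finite_subset by auto
    then show "(-1) ^ card (insert x M) * h (insert x M) = - ((-1) ^ card M * h (insert x M))"
      by simp
  qed simp
  finally show ?thesis
    by (simp add: sum_negf right_diff_distrib sum_subtractf)
qed

text \<open>
  The two subsets that differ only in \<open>x\<close> carry opposite signs.  All the cancellations in this
  development are instances of this lemma.
\<close>

lemma alternating_sum_Pow_eq_0:
  fixes h :: "'a set \<Rightarrow> real"
  assumes "finite A" "x \<in> A" "\<And>M. M \<subseteq> A - {x} \<Longrightarrow> h (insert x M) = h M"
  shows "(\<Sum>M\<in>Pow A. (-1) ^ card M * h M) = 0"
proof -
  have "(\<Sum>M\<in>Pow (insert x (A - {x})). (-1) ^ card M * h M) = 0"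
    using assms by (subst alternating_sum_Pow_insert) (auto intro!: sum.neutral)
  then show ?thesis using assms(2) by (simp add: insert_absorb)
qed

section \<open>The cyclic predecessor in a gapped cyclic order\<close>

definition cpred :: "nat set \<Rightarrow> nat \<Rightarrow> nat" where
  "cpred S x = (if \<exists>y\<in>S. y < x then Max {y \<in> S. y < x} else Max S)"

lemma cpred_cases:
  assumes "finite S" "x \<in> S"
  shows "cpred S x \<in> S \<and>
    ((cpred S x < x \<and> (\<forall>y\<in>S. y < x \<longrightarrow> y \<le> cpred S x)) \<or>
     ((\<forall>y\<in>S. x \<le> y) \<and> (\<forall>y\<in>S. y \<le> cpred S x)))"
proof (cases "\<exists>y\<in>S. y < x")
  case True
  then have "{y \<in> S. y < x} \<noteq> {}" by auto
  then have "Max {y \<in> S. y < x} \<in> {y \<in> S. y < x}"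
    using assms(1) by (intro Max_in) auto
  then show ?thesis using True assms by (auto simp: cpred_def)
next
  case False
  moreover have "Max S \<in> S" using assms by (intro Max_in) auto
  ultimately show ?thesis using assms(1) by (auto simp: cpred_def not_less)
qed

text \<open>
  The predecessor is pinned down by order conditions alone, with one case for a step inside the
  increasing listing and one for the step from the least to the greatest element.
\<close>

lemma cpred_eqI:
  assumes "finite S" "x \<in> S" "p \<in> S"
    and "(p < x \<and> (\<forall>y\<in>S. y < x \<longrightarrow> y \<le> p)) \<or> ((\<forall>y\<in>S. x \<le> y) \<and> (\<forall>y\<in>S. y \<le> p))"
  shows "cpred S x = p"
  using cpred_cases[OF assms(1,2)] assms by (metis le_antisym not_less)

lemma cpred_in: "finite S \<Longrightarrow> x \<in> S \<Longrightarrow> cpred S x \<in> S"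
  using cpred_cases by blast

lemma cpred_inj:
  assumes "finite S"
  shows "inj_on (cpred S) S"
proof (rule linorder_inj_onI)
  fix x y assume "x < y" "x \<in> S" "y \<in> S"
  then show "cpred S x \<noteq> cpred S y"
    using cpred_cases[OF assms, of x] cpred_cases[OF assms, of y] by (metis leD)
qed auto

lemma cpred_eq_iff:
  "finite S \<Longrightarrow> x \<in> S \<Longrightarrow> y \<in> S \<Longrightarrow> cpred S x = cpred S y \<longleftrightarrow> x = y"
  using cpred_inj by (auto simp: inj_on_def)

lemma cpred_surj: "finite S \<Longrightarrow> cpred S ` S = S"
  by (meson cpred_in cpred_inj endo_inj_surj image_subsetI)

lemma cpred_neq:
  assumes "finite S" "x \<in> S" "y \<in> S" "x \<noteq> y"
  shows "cpred S x \<noteq> x"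
  using cpred_cases[OF assms(1,2)] assms by (metis le_antisym less_irrefl)

text \<open>
  Removing \<open>j\<close> short-circuits the cyclic order: the element that followed \<open>j\<close> now follows the
  predecessor of \<open>j\<close>.
\<close>

lemma cpred_delete:
  assumes "finite S" "j \<in> S" "x \<in> S" "x \<noteq> j"
  shows "cpred (S - {j}) x = (if cpred S x = j then cpred S j else cpred S x)"
proof (rule cpred_eqI)
  show "finite (S - {j})" "x \<in> S - {j}" using assms by auto
  have x: "cpred S x \<in> S" and j: "cpred S j \<in> S" "cpred S j \<noteq> j"
    using assms cpred_in cpred_neq by metis+
  then show "(if cpred S x = j then cpred S j else cpred S x) \<in> S - {j}" by auto
  show "((if cpred S x = j then cpred S j else cpred S x) < x \<and>
      (\<forall>y\<in>S - {j}. y < x \<longrightarrow> y \<le> (if cpred S x = j then cpred S j else cpred S x))) \<or>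
      ((\<forall>y\<in>S - {j}. x \<le> y) \<and>
      (\<forall>y\<in>S - {j}. y \<le> (if cpred S x = j then cpred S j else cpred S x)))"
  proof (cases "cpred S x = j")
    case False
    then show ?thesis using cpred_cases[OF assms(1,3)] by auto
  next
    case True
    have cx: "(j < x \<and> (\<forall>y\<in>S. y < x \<longrightarrow> y \<le> j)) \<or> ((\<forall>y\<in>S. x \<le> y) \<and> (\<forall>y\<in>S. y \<le> j))"
      using cpred_cases[OF assms(1,3)] True by auto
    have cj: "(cpred S j < j \<and> (\<forall>y\<in>S. y < j \<longrightarrow> y \<le> cpred S j)) \<or>
       ((\<forall>y\<in>S. j \<le> y) \<and> (\<forall>y\<in>S. y \<le> cpred S j))"
      using cpred_cases[OF assms(1,2)] by auto
    define q where "q = cpred S j"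
    have q: "q < x \<and> (\<forall>y\<in>S - {j}. y < x \<longrightarrow> y \<le> q) \<or> (\<forall>y\<in>S - {j}. x \<le> y) \<and> (\<forall>y\<in>S - {j}. y \<le> q)"
      using cx
    proof
      assume x: "j < x \<and> (\<forall>y\<in>S. y < x \<longrightarrow> y \<le> j)"
      show ?thesis using cj
      proof
        assume "cpred S j < j \<and> (\<forall>y\<in>S. y < j \<longrightarrow> y \<le> cpred S j)"
        with x have "q < x \<and> (\<forall>y\<in>S - {j}. y < x \<longrightarrow> y \<le> q)"
          unfolding q_def by (metis Diff_iff insertI1 le_neq_implies_less less_trans)
        then show ?thesis ..
      next
        assume "(\<forall>y\<in>S. j \<le> y) \<and> (\<forall>y\<in>S. y \<le> cpred S j)"
        with x have "(\<forall>y\<in>S - {j}. x \<le> y) \<and> (\<forall>y\<in>S - {j}. y \<le> q)"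
          unfolding q_def by (metis DiffE insertI1 le_antisym not_less)
        then show ?thesis ..
      qed
    next
      assume x: "(\<forall>y\<in>S. x \<le> y) \<and> (\<forall>y\<in>S. y \<le> j)"
      then have "\<not> (\<forall>y\<in>S. j \<le> y)" using assms by (metis le_antisym)
      with cj have "\<forall>y\<in>S. y < j \<longrightarrow> y \<le> q" unfolding q_def by blast
      with x have "(\<forall>y\<in>S - {j}. x \<le> y) \<and> (\<forall>y\<in>S - {j}. y \<le> q)"
        by (metis DiffE insertI1 le_neq_implies_less)
      then show ?thesis ..
    qed
    then show ?thesis using True by (simp add: q_def)
  qed
qed

lemma cyclic_dist_eq:
  assumes "j \<in> {1..n}" "a \<in> {1..n}"
  shows "cyclic_dist n j a = (if j \<le> a then a - j else a + n - j)"
proof (cases "j \<le> a")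
  case True
  then have "a + n - j = (a - j) + n" by simp
  moreover have "a - j < n" using assms by auto
  ultimately show ?thesis using True unfolding cyclic_dist_def
    by (metis mod_add_self2 mod_less)
qed (use assms in \<open>auto simp: cyclic_dist_def\<close>)

lemma cyclic_dist_inj:
  assumes "j \<in> {1..n}" "a \<in> {1..n}" "b \<in> {1..n}" "cyclic_dist n j a = cyclic_dist n j b"
  shows "a = b"
  using assms by (auto simp: cyclic_dist_eq split: if_splits)

text \<open>
  Seen from \<open>j\<close>, the cyclic distance turns the cyclic order of \<open>S\<close> into a linear order with
  least element \<open>j\<close>, in which \<open>cpred\<close> is the ordinary predecessor.  This links the definition of
  \<open>next_elem\<close>, which minimises the distance in \<open>{1..n}\<close>, with the gapped order.
\<close>

lemma cyclic_dist_cpred: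
  assumes "S \<subseteq> {1..n}" "j \<in> S" "x \<in> S" "x \<noteq> j"
  shows "cyclic_dist n j (cpred S x) < cyclic_dist n j x"
    and "\<And>y. y \<in> S \<Longrightarrow> cyclic_dist n j y < cyclic_dist n j x \<Longrightarrow>
          cyclic_dist n j y \<le> cyclic_dist n j (cpred S x)"
proof -
  have fin: "finite S" using assms(1) finite_subset by auto
  define p where "p = cpred S x"
  have p: "p \<in> S" "(p < x \<and> (\<forall>y\<in>S. y < x \<longrightarrow> y \<le> p)) \<or> ((\<forall>y\<in>S. x \<le> y) \<and> (\<forall>y\<in>S. y \<le> p))"
    using cpred_cases[OF fin assms(3)] by (auto simp: p_def)
  have r: "j \<in> {1..n}" "x \<in> {1..n}" "p \<in> {1..n}" using assms p(1) by auto
  show "cyclic_dist n j (cpred S x) < cyclic_dist n j x"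
    unfolding p_def[symmetric] cyclic_dist_eq[OF r(1,2)] cyclic_dist_eq[OF r(1,3)]
    using p assms r by (auto split: if_splits)
  fix y assume y: "y \<in> S" "cyclic_dist n j y < cyclic_dist n j x"
  then have ry: "y \<in> {1..n}" using assms(1) by auto
  show "cyclic_dist n j y \<le> cyclic_dist n j (cpred S x)"
    using y(2) unfolding p_def[symmetric] cyclic_dist_eq[OF r(1,2)] cyclic_dist_eq[OF r(1,3)] cyclic_dist_eq[OF r(1) ry]
    using p y(1) assms r ry by (auto split: if_splits)
qed

lemma cyclic_dist_cpred_self:
  assumes "S \<subseteq> {1..n}" "j \<in> S" "y \<in> S"
  shows "cyclic_dist n j y \<le> cyclic_dist n j (cpred S j)"
proof -
  have fin: "finite S" using assms(1) finite_subset by auto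
  define p where "p = cpred S j"
  have p: "p \<in> S" "(p < j \<and> (\<forall>y\<in>S. y < j \<longrightarrow> y \<le> p)) \<or> ((\<forall>y\<in>S. j \<le> y) \<and> (\<forall>y\<in>S. y \<le> p))"
    using cpred_cases[OF fin assms(2)] by (auto simp: p_def)
  have r: "j \<in> {1..n}" "y \<in> {1..n}" "p \<in> {1..n}" using assms p(1) by auto
  show ?thesis
    unfolding p_def[symmetric] cyclic_dist_eq[OF r(1,2)] cyclic_dist_eq[OF r(1,3)]
    using p assms r by (auto split: if_splits)
qed

section \<open>Cyclic intervals\<close>

text \<open>
  The index is read modulo \<open>card S\<close>, so that a cyclic configuration in \<open>S\<close> unrolls to an ordinary
  increasing sequence of indices that may exceed \<open>card S\<close>.
\<close>

definition cyc_enum :: "nat set \<Rightarrow> nat \<Rightarrow> nat" where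
  "cyc_enum S i = sorted_list_of_set S ! (i mod card S)"

lemma cyc_enum_in:
  assumes "finite S" "S \<noteq> {}"
  shows "cyc_enum S i \<in> S"
proof -
  have "i mod card S < card S" using assms by (simp add: card_gt_0_iff)
  then show ?thesis
    using assms nth_mem[of "i mod card S" "sorted_list_of_set S"] by (simp add: cyc_enum_def)
qed

lemma cyc_enum_mod: "cyc_enum S (i mod card S) = cyc_enum S i"
  by (simp add: cyc_enum_def)

lemma cyc_enum_add_card: "cyc_enum S (i + card S) = cyc_enum S i"
  by (simp add: cyc_enum_def)

lemma cyc_enum_less_iff:
  assumes "finite S" "a < card S" "b < card S"
  shows "cyc_enum S a < cyc_enum S b \<longleftrightarrow> a < b"
proof -
  have s: "sorted_wrt (<) (sorted_list_of_set S)" by simp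
  have len: "length (sorted_list_of_set S) = card S" by simp
  have "x < y \<Longrightarrow> y < card S \<Longrightarrow> sorted_list_of_set S ! x < sorted_list_of_set S ! y" for x y
    using sorted_wrt_nth_less[OF s] len by simp
  then show ?thesis using assms
    by (metis cyc_enum_def linorder_neqE_nat mod_less order_less_asym)
qed

lemma cyc_enum_obtain:
  assumes "finite S" "x \<in> S"
  obtains i where "i < card S" "x = cyc_enum S i"
  using assms by (metis cyc_enum_def in_set_conv_nth mod_less set_sorted_list_of_set
      length_sorted_list_of_set)

lemma cyc_enum_eq_iff:
  assumes "finite S" "S \<noteq> {}"
  shows "cyc_enum S a = cyc_enum S b \<longleftrightarrow> a mod card S = b mod card S"
proof -
  have "a mod card S < card S" "b mod card S < card S"
    using assms by (simp_all add: card_gt_0_iff)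
  then show ?thesis
    using cyc_enum_less_iff[OF assms(1)] by (metis cyc_enum_mod less_irrefl linorder_neqE_nat)
qed

lemma cyc_enum_obtain_from:
  assumes "finite S" "x \<in> S"
  obtains i where "i < card S" "x = cyc_enum S (r + i)"
proof -
  obtain a where a: "a < card S" "x = cyc_enum S a"
    using cyc_enum_obtain[OF assms] .
  define N where "N = card S"
  have N: "0 < N" using a N_def by simp
  define i where "i = (a + (N - r mod N)) mod N"
  have "i < N" using N by (simp add: i_def)
  moreover have "(r + i) mod N = a mod N"
  proof -
    have "(r + i) mod N = (r mod N + (a + (N - r mod N))) mod N"
      unfolding i_def by (simp add: mod_simps)
    also have "r mod N + (a + (N - r mod N)) = a + N"
      using mod_less_divisor[OF N, of r] by linarith
    finally show ?thesis by simp
  qed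
  ultimately show ?thesis
    using that a(2) by (metis N_def cyc_enum_mod)
qed

lemma cpred_cyc_enum:
  assumes "finite S" "S \<noteq> {}"
  shows "cpred S (cyc_enum S (Suc i)) = cyc_enum S i"
proof -
  define N where "N = card S"
  have N: "0 < N" using assms by (simp add: N_def card_gt_0_iff)
  define a where "a = i mod N"
  define b where "b = Suc i mod N"
  have ab: "a < N" "b < N" "b = (if Suc a = N then 0 else Suc a)"
    using N by (auto simp: a_def b_def mod_Suc intro: Suc_lessI)
  have e: "cyc_enum S i = cyc_enum S a" "cyc_enum S (Suc i) = cyc_enum S b"
    by (simp_all add: a_def b_def N_def cyc_enum_mod)
  show ?thesis unfolding e
  proof (rule cpred_eqI)
    show "(cyc_enum S a < cyc_enum S b \<and> (\<forall>y\<in>S. y < cyc_enum S b \<longrightarrow> y \<le> cyc_enum S a)) \<or>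
      ((\<forall>y\<in>S. cyc_enum S b \<le> y) \<and> (\<forall>y\<in>S. y \<le> cyc_enum S a))"
    proof (cases "Suc a = N")
      case True
      have "cyc_enum S b \<le> y \<and> y \<le> cyc_enum S a" if "y \<in> S" for y
      proof -
        obtain c where "c < N" "y = cyc_enum S c"
          using cyc_enum_obtain[OF assms(1) \<open>y \<in> S\<close>] N_def by metis
        then show ?thesis using cyc_enum_less_iff[OF assms(1)] ab True
          by (simp add: N_def[symmetric] flip: not_less)
      qed
      then show ?thesis by blast
    next
      case False
      have "y \<le> cyc_enum S a" if "y \<in> S" "y < cyc_enum S b" for y
      proof -
        obtain c where "c < N" "y = cyc_enum S c"
          using cyc_enum_obtain[OF assms(1) \<open>y \<in> S\<close>] N_def by metis
        then show ?thesis using cyc_enum_less_iff[OF assms(1)] ab False that(2)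
          by (simp add: N_def[symmetric] flip: not_less)
      qed
      moreover have "cyc_enum S a < cyc_enum S b"
        using cyc_enum_less_iff[OF assms(1)] ab False by (simp add: N_def)
      ultimately show ?thesis by blast
    qed
  qed (use assms cyc_enum_in in auto)
qed

lemma cyclic_interval_iff_cyc_enum:
  assumes "finite S" "S \<noteq> {}"
  shows "cyclic_interval S J \<longleftrightarrow> (\<exists>r m. m \<le> card S \<and> J = (\<lambda>i. cyc_enum S (r + i)) ` {..<m})"
proof -
  define s where "s = sorted_list_of_set S"
  have len: "length s = card S" by (simp add: s_def)
  have N: "0 < card S" using assms by (simp add: card_gt_0_iff)
  have *: "set (take m (rotate r s)) = (\<lambda>i. cyc_enum S (r + i)) ` {..<min m (card S)}" for r m
  proof -
    have "set (take m (rotate r s)) = set (take (min m (card S)) (rotate r s))"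
      by (simp add: len min_def)
    also have "\<dots> = (\<lambda>i. rotate r s ! i) ` {..<min m (card S)}"
      by (subst nth_image[symmetric]) (auto simp: len)
    also have "\<dots> = (\<lambda>i. cyc_enum S (r + i)) ` {..<min m (card S)}"
      by (intro image_cong) (auto simp: nth_rotate len cyc_enum_def s_def)
    finally show ?thesis .
  qed
  show ?thesis unfolding cyclic_interval_def s_def[symmetric] *
    by (metis min.cobounded2 min.absorb1)
qed

definition initials :: "nat set \<Rightarrow> nat set \<Rightarrow> nat set" where
  "initials S J = {x \<in> J. cpred S x \<notin> J}"

text \<open>
  A set is a cyclic interval exactly when it is entered at most once on the way round.  For the
  converse, walking back from any element one leaves \<open>J\<close> only at the unique entry point \<open>a\<close>, so \<open>J\<close>
  is an initial segment of the walk that starts at \<open>a\<close>.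
\<close>

lemma cyclic_interval_iff_initials:
  assumes "finite S" "S \<noteq> {}" "J \<subseteq> S"
  shows "cyclic_interval S J \<longleftrightarrow> card (initials S J) \<le> 1"
proof
  assume "cyclic_interval S J"
  then obtain r m where J: "J = (\<lambda>i. cyc_enum S (r + i)) ` {..<m}"
    using cyclic_interval_iff_cyc_enum assms by auto
  have "initials S J \<subseteq> {cyc_enum S r}"
  proof
    fix x assume x: "x \<in> initials S J"
    then obtain i where i: "i < m" "x = cyc_enum S (r + i)" by (auto simp: initials_def J)
    have "i = 0"
    proof (rule ccontr)
      assume "i \<noteq> 0"
      then obtain i' where "i = Suc i'" using not0_implies_Suc by blast
      then have "cpred S x = cyc_enum S (r + i')" "i' < m"
        using i cpred_cyc_enum[OF assms(1,2)] by auto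
      then have "cpred S x \<in> J" by (auto simp: J)
      then show False using x by (simp add: initials_def)
    qed
    then show "x \<in> {cyc_enum S r}" using i by simp
  qed
  then show "card (initials S J) \<le> 1"
    using card_mono[of "{cyc_enum S r}"] by simp
next
  have fin: "finite (initials S J)" using assms by (simp add: initials_def finite_subset)
  assume le: "card (initials S J) \<le> 1"
  have "\<exists>r m. m \<le> card S \<and> J = (\<lambda>i. cyc_enum S (r + i)) ` {..<m}"
  proof (cases "J = {}")
    case True
    then show ?thesis by (intro exI[of _ 0]) auto
  next
    case False
    \<comment> \<open>If there is no entry point, then \<open>J\<close> is all of \<open>S\<close> and any of its points can serve as \<open>a\<close>.\<close>
    obtain a where a: "a \<in> J" "initials S J \<subseteq> {a}"
    proof (cases "initials S J = {}")
      case True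
      then show ?thesis using that False by auto
    next
      case ne: False
      then have "card (initials S J) = 1"
        using le fin by (metis card_0_eq le_less less_one)
      then obtain a where "initials S J = {a}" by (auto simp: card_1_singleton_iff)
      then show ?thesis using that[of a] by (auto simp: initials_def)
    qed
    obtain r where r: "a = cyc_enum S r"
      using a assms cyc_enum_obtain by (metis subsetD)
    \<comment> \<open>Walking back from an element of \<open>J\<close> one stays in \<open>J\<close> until \<open>a\<close> is reached.\<close>
    have step_back: "cyc_enum S (r + i) \<in> J" if "cyc_enum S (r + Suc i) \<in> J" "Suc i < card S" for i
    proof -
      have "cyc_enum S (r + Suc i) \<noteq> a"
      proof
        assume "cyc_enum S (r + Suc i) = a"
        then have "(r + Suc i) mod card S = (r + 0) mod card S"
          using r cyc_enum_eq_iff[OF assms(1,2)] by simp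
        then have "card S dvd Suc i"
          using mod_eq_dvd_iff_nat[of r "r + Suc i" "card S"] by simp
        then show False using that(2) by (auto dest: dvd_imp_le)
      qed
      then have "cyc_enum S (r + Suc i) \<notin> initials S J" using a by auto
      then show ?thesis using that(1) cpred_cyc_enum[OF assms(1,2)] by (simp add: initials_def)
    qed
    have down: "cyc_enum S (r + i) \<in> J" if "cyc_enum S (r + i') \<in> J" "i \<le> i'" "i' < card S" for i i'
      using that(2,1,3)
      by (induction i' rule: dec_induct) (use step_back in auto)
    \<comment> \<open>The bound \<open>card S\<close> guards against going round forever, which happens for \<open>J = S\<close>.\<close>
    define m where "m = (LEAST m. cyc_enum S (r + m) \<notin> J \<or> card S \<le> m)"
    have m: "cyc_enum S (r + m) \<notin> J \<or> card S \<le> m"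
      unfolding m_def by (rule LeastI[of _ "card S"]) simp
    have below: "cyc_enum S (r + i) \<in> J \<and> i < card S" if "i < m" for i
      using not_less_Least[of i "\<lambda>m. cyc_enum S (r + m) \<notin> J \<or> card S \<le> m"] that
      by (simp add: m_def)
    have "m \<le> card S" unfolding m_def by (rule Least_le) simp
    moreover have "J = (\<lambda>i. cyc_enum S (r + i)) ` {..<m}"
    proof
      show "J \<subseteq> (\<lambda>i. cyc_enum S (r + i)) ` {..<m}"
      proof
        fix x assume x: "x \<in> J"
        then obtain i where i: "i < card S" "x = cyc_enum S (r + i)"
          using cyc_enum_obtain_from[of S x r] assms by auto
        have "i < m" using m down[of i m] x i by (metis down leD le_less_linear order.strict_trans1)
        then show "x \<in> (\<lambda>i. cyc_enum S (r + i)) ` {..<m}" using i by auto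
      qed
    qed (use below in auto)
    ultimately show ?thesis by blast
  qed
  then show "cyclic_interval S J" using cyclic_interval_iff_cyc_enum assms by auto
qed

section \<open>Boundary operators on the elements \<open>\<L>\<^sub>J\<close>\<close>

definition shift_down :: "nat set \<Rightarrow> nat set \<Rightarrow> nat set \<Rightarrow> nat set" where
  "shift_down S J M = (\<lambda>x. if x \<in> M then cpred S x else x) ` J"

text \<open>
  A shifted initial point lands outside \<open>J\<close>, so it cannot collide with a point that stays.
\<close>

lemma shift_down_inj:
  assumes "finite S" "J \<subseteq> S" "M \<subseteq> initials S J"
  shows "inj_on (\<lambda>x. if x \<in> M then cpred S x else x) J"
  using assms(2,3) cpred_eq_iff[OF assms(1)]
  by (auto simp: inj_on_def initials_def subset_iff)

lemma shift_down_subset: "finite S \<Longrightarrow> J \<subseteq> S \<Longrightarrow> shift_down S J M \<subseteq> S"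
  by (auto simp: shift_down_def cpred_in subset_iff)

lemma card_shift_down:
  "finite S \<Longrightarrow> J \<subseteq> S \<Longrightarrow> M \<subseteq> initials S J \<Longrightarrow> card (shift_down S J M) = card J"
  unfolding shift_down_def by (rule card_image) (rule shift_down_inj)

lemma shift_down_remove:
  assumes "finite S" "J \<subseteq> S" "M \<subseteq> initials S J" "i \<in> J"
  shows "shift_down S J M - {if i \<in> M then cpred S i else i} = shift_down S (J - {i}) (M - {i})"
proof -
  let ?f = "\<lambda>x. if x \<in> M then cpred S x else x"
  have "?f ` J - {?f i} = ?f ` (J - {i})"
    using shift_down_inj[OF assms(1-3)] assms(4) by (auto simp: inj_on_def)
  also have "\<dots> = shift_down S (J - {i}) (M - {i})"
    unfolding shift_down_def by (intro image_cong) auto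
  finally show ?thesis by (simp add: shift_down_def)
qed

lemma next_elem_least:
  assumes "J \<subseteq> {1..n}" "J \<noteq> {}" "j \<in> {1..n}"
  shows "next_elem n J j \<in> J"
    and "\<And>x. x \<in> J \<Longrightarrow> cyclic_dist n j (next_elem n J j) \<le> cyclic_dist n j x"
proof -
  have "finite J" using assms(1) finite_subset by auto
  note am = arg_min_if_finite[OF this assms(2), of "cyclic_dist n j"]
  show "next_elem n J j \<in> J" using am by (simp add: next_elem_def)
  fix x assume x: "x \<in> J"
  show "cyclic_dist n j (next_elem n J j) \<le> cyclic_dist n j x"
  proof (cases "j \<in> J")
    case True
    then show ?thesis using cyclic_dist_eq[OF assms(3,3)] by (simp add: next_elem_def)
  next
    case False
    then show ?thesis using am x by (auto simp: next_elem_def not_less)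
  qed
qed

lemma next_elem_eqI:
  assumes "J \<subseteq> {1..n}" "j \<in> {1..n}" "i \<in> J" "\<And>x. x \<in> J \<Longrightarrow> cyclic_dist n j i \<le> cyclic_dist n j x"
  shows "next_elem n J j = i"
proof (rule cyclic_dist_inj)
  note ne = next_elem_least[OF assms(1) _ assms(2)]
  have "J \<noteq> {}" using assms by auto
  note ne = ne[OF this]
  show "j \<in> {1..n}" by fact
  show "next_elem n J j \<in> {1..n}" "i \<in> {1..n}" using ne(1) assms by auto
  show "cyclic_dist n j (next_elem n J j) = cyclic_dist n j i"
    using ne assms(3,4) by (meson le_antisym)
qed

lemma initials_delete_next:
  assumes "S \<subseteq> {1..n}" "j \<in> S" "J \<subseteq> S" "J \<noteq> {}" "j \<notin> J" "initials S J \<subseteq> {a}"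
  shows "initials (S - {j}) (J - {next_elem n J j}) \<subseteq> {x \<in> S. cpred S x = next_elem n J j}"
proof
  have fin: "finite S" using assms(1) by (rule finite_subset) simp
  define i where "i = next_elem n J j"
  have "J \<subseteq> {1..n}" "j \<in> {1..n}" using assms by auto
  then have i: "i \<in> J" "\<And>x. x \<in> J \<Longrightarrow> cyclic_dist n j i \<le> cyclic_dist n j x"
    using next_elem_least[of J n j] assms(4) by (auto simp only: i_def)
  have "i \<noteq> j" using i assms by auto
  then have "cpred S i \<notin> J"
    using cyclic_dist_cpred(1)[of S n j i] i assms by fastforce
  then have init: "i \<in> initials S J" using i by (simp add: initials_def)
  fix x assume "x \<in> initials (S - {j}) (J - {next_elem n J j})"
  then have x: "x \<in> J" "x \<noteq> i" "cpred (S - {j}) x \<notin> J - {i}"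
    by (auto simp: initials_def i_def)
  then have "x \<notin> initials S J" using init assms(6) by auto
  then have "cpred S x \<in> J" using x by (simp add: initials_def)
  moreover from this have "cpred (S - {j}) x = cpred S x"
    by (metis cpred_delete[OF fin assms(2)] x(1) assms(3,5) subsetD)
  ultimately show "x \<in> {x \<in> S. cpred S x = next_elem n J j}"
    using x assms by (auto simp: i_def)
qed

text \<open>
  Deleting a member \<open>j\<close> of \<open>J\<close> from the ground set keeps the intervals of \<open>J\<close> as they are, except
  that the role of initial point passes from \<open>j\<close> to its successor when that belongs to \<open>J\<close>.
\<close>

lemma initials_delete:
  assumes "finite S" "j \<in> J" "J \<subseteq> S" "J \<noteq> {j}"
  shows "initials (S - {j}) (J - {j}) =
    (initials S J - {j}) \<union> {s \<in> J. cpred S s = j \<and> j \<in> initials S J}"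
proof -
  have j: "j \<in> S" using assms by auto
  obtain y where y: "y \<in> S" "y \<noteq> j" using assms by auto
  have pj: "cpred S j \<noteq> j" using cpred_neq[OF assms(1) j y(1)] y(2) by auto
  have "x \<in> initials (S - {j}) (J - {j}) \<longleftrightarrow>
      x \<in> initials S J \<or> cpred S x = j \<and> j \<in> initials S J" if x: "x \<in> J" "x \<noteq> j" for x
  proof -
    have "x \<in> S" using x assms by auto
    show ?thesis
    proof (cases "cpred S x = j")
      case True
      then have "cpred (S - {j}) x = cpred S j"
        using cpred_delete[OF assms(1) j \<open>x \<in> S\<close> x(2)] by simp
      then show ?thesis using True x assms(2) pj by (simp add: initials_def)
    next
      case False
      then have "cpred (S - {j}) x = cpred S x"
        using cpred_delete[OF assms(1) j \<open>x \<in> S\<close> x(2)] by simp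
      then show ?thesis using False x by (simp add: initials_def)
    qed
  qed
  note mem = this
  show ?thesis
  proof (rule set_eqI)
    fix x
    show "x \<in> initials (S - {j}) (J - {j}) \<longleftrightarrow>
      x \<in> (initials S J - {j}) \<union> {s \<in> J. cpred S s = j \<and> j \<in> initials S J}"
    proof (cases "x \<in> J \<and> x \<noteq> j")
      case True
      then show ?thesis using mem[of x] by blast
    next
      case False
      then show ?thesis using pj by (auto simp: initials_def)
    qed
  qed
qed

lemma card_initials_delete:
  assumes "finite S" "j \<in> J" "J \<subseteq> S" "J \<noteq> {j}"
  shows "card (initials (S - {j}) (J - {j})) \<le> card (initials S J)"
proof -
  have fin: "finite (initials S J)" using assms(1,3) by (simp add: initials_def finite_subset)
  show ?thesis
  proof (cases "j \<in> initials S J \<and> (\<exists>s\<in>J. cpred S s = j)")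
    case True
    then obtain s where s: "s \<in> J" "cpred S s = j" by auto
    then have "{s \<in> J. cpred S s = j \<and> j \<in> initials S J} \<subseteq> {s}"
      using cpred_eq_iff[OF assms(1), of _ s] assms(3) by auto
    then have "initials (S - {j}) (J - {j}) \<subseteq> insert s (initials S J - {j})"
      using initials_delete[OF assms] by auto
    then have "card (initials (S - {j}) (J - {j})) \<le> card (insert s (initials S J - {j}))"
      using fin by (intro card_mono) auto
    also have "\<dots> \<le> Suc (card (initials S J - {j}))" by (simp add: card_insert_if fin)
    also have "\<dots> = card (initials S J)" using True fin by (intro card_Suc_Diff1) auto
    finally show ?thesis .
  next
    case False
    then have "initials (S - {j}) (J - {j}) \<subseteq> initials S J"
      using initials_delete[OF assms] by auto
    then show ?thesis using fin by (intro card_mono)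
  qed
qed

text \<open>
  This makes \<open>\<partial>\<^sub>j\<close> compatible with the convention that \<open>\<beta>\<^sub>J = 0\<close> for frozen \<open>J\<close>: the set that it
  would assign to a frozen \<open>J\<close> is again frozen.
\<close>

lemma cyclic_interval_delete_next:
  assumes "S \<subseteq> {1..n}" "j \<in> S" "S \<noteq> {j}" "J \<subseteq> S" "J \<noteq> {}" "cyclic_interval S J"
  shows "cyclic_interval (S - {j}) (J - {next_elem n J j})"
proof -
  have fin: "finite S" using assms(1) by (rule finite_subset) simp
  have S: "finite (S - {j})" "S - {j} \<noteq> {}" using fin assms(2,3) by blast+
  have le: "card (initials S J) \<le> 1"
    using cyclic_interval_iff_initials[OF fin _ assms(4)] assms(2,6) by blast
  show ?thesis
  proof (cases "j \<in> J")
    case True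
    then have n: "next_elem n J j = j" by (simp add: next_elem_def)
    show ?thesis
    proof (cases "J = {j}")
      case True
      then show ?thesis unfolding n using cyclic_interval_iff_initials[OF S, of "J - {j}"]
        by (simp add: initials_def)
    next
      case False
      then show ?thesis unfolding n using cyclic_interval_iff_initials[OF S, of "J - {j}"]
          card_initials_delete[OF fin True assms(4)] le assms(4) by auto
    qed
  next
    case False
    define i where "i = next_elem n J j"
    have "J \<subseteq> {1..n}" "j \<in> {1..n}" using assms by auto
    then have i: "i \<in> J" using next_elem_least(1)[of J n j] assms(5) by (simp add: i_def)
    have "finite (initials S J)" using fin assms(4) by (simp add: initials_def finite_subset)
    then obtain a where "initials S J \<subseteq> {a}" 
      using le by (metis card_1_singletonE card_0_eq empty_subsetI le_less less_one order_refl)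
    from initials_delete_next[OF assms(1,2,4,5) False this]
    have sub: "initials (S - {j}) (J - {i}) \<subseteq> {x \<in> S. cpred S x = i}" by (simp add: i_def)
    have "card {x \<in> S. cpred S x = i} \<le> 1"
      using cpred_eq_iff[OF fin] by (auto simp: card_le_Suc0_iff_eq fin)
    then have "card (initials (S - {j}) (J - {i})) \<le> 1"
      using card_mono[OF _ sub] fin by auto
    then show ?thesis
      using cyclic_interval_iff_initials[OF S, of "J - {i}"] assms False by (auto simp: i_def)
  qed
qed

text \<open>
  Source of the cancellations in \<open>\<partial>\<^sub>j \<L>\<^sub>J\<close>.  Suppose that \<open>i\<close> is the first point of \<open>J\<close> after \<open>j\<close>
  and starts an interval, and that \<open>j\<close> itself has moved away or is not in \<open>J\<close>.  Then \<open>\<partial>\<^sub>j\<close> deletes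
  what has become of \<open>i\<close>, so it makes no difference whether \<open>i\<close> had been shifted.
\<close>

lemma shift_down_remove_next:
  assumes "S \<subseteq> {1..n}" "j \<in> S" "J \<subseteq> S" "M \<subseteq> initials S J"
    and "i \<in> initials S J" "i \<noteq> j" "\<And>x. x \<in> J - {j} \<Longrightarrow> cyclic_dist n j i \<le> cyclic_dist n j x"
    and "j \<in> J \<Longrightarrow> j \<in> M"
  shows "shift_down S J M - {next_elem n (shift_down S J M) j} = shift_down S (J - {i}) (M - {i})"
proof -
  have fin: "finite S" using assms(1) by (rule finite_subset) simp
  define d where "d = cyclic_dist n j"
  have i: "i \<in> J" "cpred S i \<notin> J" "i \<in> S" using assms by (auto simp: initials_def)
  have dp: "d (cpred S i) < d i"
    unfolding d_def using cyclic_dist_cpred(1)[OF assms(1,2) i(3) assms(6)] .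
  have "next_elem n (shift_down S J M) j = (if i \<in> M then cpred S i else i)"
  proof (rule next_elem_eqI)
    show "shift_down S J M \<subseteq> {1..n}" using shift_down_subset[OF fin assms(3)] assms(1) by blast
    show "j \<in> {1..n}" using assms by auto
    show "(if i \<in> M then cpred S i else i) \<in> shift_down S J M"
      using i by (auto simp: shift_down_def)
    fix y assume "y \<in> shift_down S J M"
    then obtain x where x: "x \<in> J" "y = (if x \<in> M then cpred S x else x)"
      by (auto simp: shift_down_def)
    have xS: "x \<in> S" using x assms by auto
    show "cyclic_dist n j (if i \<in> M then cpred S i else i) \<le> cyclic_dist n j y"
    proof (cases "x = i")
      case True
      then show ?thesis using x by simp
    next
      case False
      have "d i \<le> d y"
      proof (cases "x \<in> M")
        case True
        then have y: "y = cpred S x" "y \<notin> J" using x assms by (auto simp: initials_def)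
        show ?thesis
        proof (cases "x = j")
          case True
          then show ?thesis using cyclic_dist_cpred_self[OF assms(1,2) i(3)] y by (simp add: d_def)
        next
          case xj: False
          then have "d i \<le> d x" using assms(7) x by (auto simp: d_def)
          moreover have "d i \<noteq> d x"
            unfolding d_def using cyclic_dist_inj[of j n i x] False assms(1,2) i(3) xS
            by (metis subsetD)
          ultimately show ?thesis
            using cyclic_dist_cpred(2)[OF assms(1,2) xS xj i(3)] y by (simp add: d_def)
        qed
      next
        case False
        then show ?thesis using x assms(7,8) by (auto simp: d_def)
      qed
      then show ?thesis using dp by (auto simp: d_def)
    qed
  qed
  then show ?thesis using shift_down_remove[OF fin assms(3,4) i(1)] by simp
qed

text \<open>
  The element \<open>\<L>\<^sub>J\<close> of the blade space for \<open>L\<close>, formed with the cyclic order that \<open>{1..n} - L\<close>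
  inherits.  These are needed because they are the images of the \<open>\<L>\<^sub>J\<close> under \<open>\<partial>\<^sub>L\<close>.
\<close>

definition gapped_L_elem :: "nat \<Rightarrow> nat set \<Rightarrow> nat set \<Rightarrow> (nat set \<Rightarrow> real)" where
  "gapped_L_elem n L J = (\<lambda>K. \<Sum>M\<in>Pow (initials ({1..n} - L) J).
     (-1) ^ card M * blade n L (shift_down ({1..n} - L) J M) K)"

lemma sum_blade:
  assumes "J \<subseteq> {1..n} - L" "card J + card L = k"
  shows "(\<Sum>K\<in>blade_index n k L. blade n L J K * g K) = (if frozen n L J then 0 else g J)"
proof -
  have "finite (blade_index n k L)"
    by (rule finite_subset[of _ "Pow {1..n}"]) (auto simp: blade_index_def)
  moreover have "blade n L J K * g K = (if K = J then (if frozen n L J then 0 else g J) else 0)" for K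
    by (auto simp: blade_def)
  ultimately show ?thesis using assms by (simp add: blade_index_def)
qed

text \<open>
  The boundary is defined by its values on nonfrozen basis elements only.  The same formula may be
  used for the frozen terms of \<open>\<L>\<^sub>J\<close>, since it gives \<open>0\<close> for them.
\<close>

lemma boundary_gapped_L_elem_expand:
  assumes "L \<subseteq> {1..n}" "j \<in> {1..n} - L" "J \<subseteq> {1..n} - L" "card J + card L = k" "2 \<le> card J"
  shows "boundary n k L j (gapped_L_elem n L J) K =
    (\<Sum>M\<in>Pow (initials ({1..n} - L) J). (-1) ^ card M *
      blade n (insert j L) (shift_down ({1..n} - L) J M
        - {next_elem n (shift_down ({1..n} - L) J M) j}) K)"
proof -
  define S where "S = {1..n} - L"
  define b where "b = (\<lambda>J'. blade n (insert j L) (J' - {next_elem n J' j}) K)"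
  have fin: "finite S" by (simp add: S_def)
  have S: "S \<subseteq> {1..n}" "j \<in> S" "J \<subseteq> S" using assms by (auto simp: S_def)
  have ins: "{1..n} - insert j L = S - {j}" by (auto simp: S_def)
  have "boundary n k L j (gapped_L_elem n L J) K =
    (\<Sum>J'\<in>blade_index n k L. \<Sum>M\<in>Pow (initials S J). (-1) ^ card M * (blade n L (shift_down S J M) J' * b J'))"
    using assms(2) by (simp add: boundary_def gapped_L_elem_def b_def sum_distrib_right S_def mult.assoc)
  also have "\<dots> = (\<Sum>M\<in>Pow (initials S J). (-1) ^ card M *
      (\<Sum>J'\<in>blade_index n k L. blade n L (shift_down S J M) J' * b J'))"
    by (subst sum.swap) (simp add: sum_distrib_left)
  also have "\<dots> = (\<Sum>M\<in>Pow (initials S J). (-1) ^ card M * b (shift_down S J M))"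
  proof (rule sum.cong)
    fix M assume "M \<in> Pow (initials S J)"
    then have M: "M \<subseteq> initials S J" by simp
    define J' where "J' = shift_down S J M"
    have J': "J' \<subseteq> S" "card J' = card J"
      using shift_down_subset[OF fin S(3)] card_shift_down[OF fin S(3) M] by (auto simp: J'_def)
    have "b J' = 0" if "frozen n L J'"
    proof -
      have "J' \<noteq> {}" "S \<noteq> {j}"
        using J' assms(5) card_mono[of "{j}" J'] by auto
      then have "cyclic_interval (S - {j}) (J' - {next_elem n J' j})"
        using cyclic_interval_delete_next[OF S(1,2) _ J'(1)] that
        by (simp add: frozen_def S_def)
      then show ?thesis unfolding b_def blade_def frozen_def ins by simp
    qed
    moreover have "(\<Sum>K'\<in>blade_index n k L. blade n L J' K' * b K') = (if frozen n L J' then 0 else b J')"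
      using sum_blade[of J' n L k b] J' assms(4) by (simp add: S_def)
    ultimately show "(-1) ^ card M * (\<Sum>J'\<in>blade_index n k L. blade n L (shift_down S J M) J' * b J') =
        (-1) ^ card M * b (shift_down S J M)"
      by (simp add: J'_def)
  qed simp
  finally show ?thesis by (simp add: b_def S_def)
qed

text \<open>
  The first point of \<open>J\<close> after \<open>j\<close> starts an interval, and shifting it has no effect after \<open>\<partial>\<^sub>j\<close>.
\<close>

lemma boundary_gapped_L_elem_notin:
  assumes "L \<subseteq> {1..n}" "j \<in> {1..n} - L" "J \<subseteq> {1..n} - L" "card J + card L = k" "2 \<le> card J"
    and "j \<notin> J"
  shows "boundary n k L j (gapped_L_elem n L J) = (\<lambda>_. 0)"
proof
  fix K
  define S where "S = {1..n} - L"
  have fin: "finite S" by (simp add: S_def)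
  have S: "S \<subseteq> {1..n}" "j \<in> S" "J \<subseteq> S" using assms by (auto simp: S_def)
  have "J \<subseteq> {1..n}" "J \<noteq> {}" "j \<in> {1..n}" using S assms by auto
  note ne = next_elem_least[OF this]
  define i where "i = next_elem n J j"
  have i: "i \<in> J" "i \<noteq> j" "\<And>x. x \<in> J \<Longrightarrow> cyclic_dist n j i \<le> cyclic_dist n j x"
    using ne assms(6) by (auto simp only: i_def)
  then have "cpred S i \<notin> J"
    using cyclic_dist_cpred(1)[OF S(1,2), of i] S(3) by fastforce
  then have init: "i \<in> initials S J" using i by (simp add: initials_def)
  have "(\<Sum>M\<in>Pow (initials S J). (-1) ^ card M * blade n (insert j L)
      (shift_down S J M - {next_elem n (shift_down S J M) j}) K) = 0"
  proof (rule alternating_sum_Pow_eq_0[OF _ init])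
    show "finite (initials S J)" using fin S by (simp add: initials_def finite_subset)
    fix M assume M: "M \<subseteq> initials S J - {i}"
    have *: "shift_down S J M' - {next_elem n (shift_down S J M') j} = shift_down S (J - {i}) (M' - {i})"
      if "M' \<subseteq> initials S J" for M'
      using shift_down_remove_next[OF S that init i(2)] i(3) assms(6) by blast
    have "M \<subseteq> initials S J" "insert i M \<subseteq> initials S J" "insert i M - {i} = M - {i}"
      using M init by auto
    then show "blade n (insert j L) (shift_down S J (insert i M)
        - {next_elem n (shift_down S J (insert i M)) j}) K =
      blade n (insert j L) (shift_down S J M - {next_elem n (shift_down S J M) j}) K"
      using *[of M] *[of "insert i M"] by simp
  qed
  then show "boundary n k L j (gapped_L_elem n L J) K = 0"
    using boundary_gapped_L_elem_expand[OF assms(1-5)] by (simp add: S_def)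
qed

text \<open>
  The terms in which \<open>j\<close> stays agree one by one with the terms for \<open>J - {j}\<close> with the same \<open>M\<close>, and
  there are no others unless \<open>j\<close> is an initial point of \<open>J\<close>.  In that case let \<open>s\<close> be the successor of
  \<open>j\<close> in \<open>S\<close>, and consider the terms in which \<open>j\<close> moves back.  If \<open>s \<in> J\<close>, then \<open>\<partial>\<^sub>j\<close> deletes \<open>s\<close>,
  and the set that is left is the one obtained from \<open>J - {j}\<close> by moving \<open>s\<close> back past the deleted
  point.  If \<open>s \<notin> J\<close>, these terms cancel, since the next point of \<open>J\<close> starts another interval.
\<close>

lemma boundary_gapped_L_elem_in:
  assumes "L \<subseteq> {1..n}" "j \<in> {1..n} - L" "J \<subseteq> {1..n} - L" "card J + card L = k" "2 \<le> card J"
    and "j \<in> J"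
  shows "boundary n k L j (gapped_L_elem n L J) = gapped_L_elem n (insert j L) (J - {j})"
proof
  fix K
  define S where "S = {1..n} - L"
  have fin: "finite S" by (simp add: S_def)
  have S: "S \<subseteq> {1..n}" "j \<in> S" "J \<subseteq> S" using assms by (auto simp: S_def)
  have ins: "{1..n} - insert j L = S - {j}" by (auto simp: S_def)
  have finJ: "finite J" using S fin finite_subset by blast
  have fini: "finite (initials S J)" using finJ by (simp add: initials_def)
  have Jj: "J \<noteq> {j}" using assms(5) by auto
  obtain y where y: "y \<in> S" "y \<noteq> j" using Jj S assms(6) by blast
  have pj: "cpred S j \<noteq> j" using cpred_neq[OF fin S(2) y(1)] y(2) by auto
  define h where "h = (\<lambda>J'. blade n (insert j L) J' K)"
  define R where "R = (\<lambda>M. shift_down S J M - {next_elem n (shift_down S J M) j})"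
  define Q where "Q = (\<lambda>M. shift_down (S - {j}) (J - {j}) M)"
  have lhs: "boundary n k L j (gapped_L_elem n L J) K = (\<Sum>M\<in>Pow (initials S J). (-1) ^ card M * h (R M))"
    using boundary_gapped_L_elem_expand[OF assms(1-5)] by (simp add: S_def h_def R_def)
  have rhs: "gapped_L_elem n (insert j L) (J - {j}) K =
    (\<Sum>M\<in>Pow (initials (S - {j}) (J - {j})). (-1) ^ card M * h (Q M))"
    unfolding gapped_L_elem_def ins h_def Q_def ..
  have subset_n: "shift_down S J M \<subseteq> {1..n}" for M
    using shift_down_subset[OF fin S(3)] S(1) by blast
  \<comment> \<open>As long as \<open>j\<close> stays in place, it is the element that \<open>\<partial>\<^sub>j\<close> removes.\<close>
  have stay: "R M = Q M" if M: "M \<subseteq> initials S J" "j \<notin> M" for M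
  proof -
    have "j \<in> shift_down S J M" using assms(6) M by (auto simp: shift_down_def)
    then have "next_elem n (shift_down S J M) j = j" by (simp add: next_elem_def)
    then have "R M = shift_down S (J - {j}) M"
      using shift_down_remove[OF fin S(3) M(1) assms(6)] M(2) by (simp add: R_def)
    also have "\<dots> = Q M"
      unfolding Q_def shift_down_def
    proof (rule image_cong)
      fix x assume x: "x \<in> J - {j}"
      have "cpred (S - {j}) x = cpred S x" if "x \<in> M"
      proof -
        have "cpred S x \<noteq> j" using that M assms(6) by (auto simp: initials_def)
        then show ?thesis using cpred_delete[OF fin S(2), of x] x S(3) by auto
      qed
      then show "(if x \<in> M then cpred S x else x) = (if x \<in> M then cpred (S - {j}) x else x)" by simp
    qed simp
    finally show ?thesis .
  qed
  show "boundary n k L j (gapped_L_elem n L J) K = gapped_L_elem n (insert j L) (J - {j}) K"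
  proof (cases "j \<in> initials S J")
    case False
    then have "initials (S - {j}) (J - {j}) = initials S J"
      using initials_delete[OF fin assms(6) S(3) Jj] by auto
    moreover have "R M = Q M" if "M \<subseteq> initials S J" for M using stay[OF that] that False by blast
    ultimately show ?thesis unfolding lhs rhs by (intro sum.cong) auto
  next
    case True
    define A where "A = initials S J - {j}"
    have A: "finite A" "j \<notin> A" "initials S J = insert j A" using fini True by (auto simp: A_def)
    have lhs': "boundary n k L j (gapped_L_elem n L J) K =
        (\<Sum>M\<in>Pow A. (-1) ^ card M * (h (R M) - h (R (insert j M))))"
      unfolding lhs A(3) by (rule alternating_sum_Pow_insert[OF A(1,2)])
    have RQ: "R M = Q M" if "M \<subseteq> A" for M using stay[of M] that A by auto
    show ?thesis
    proof (cases "\<exists>s\<in>J. cpred S s = j")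
      case True
      then obtain s where s: "s \<in> J" "cpred S s = j" by auto
      have sS: "s \<in> S" "s \<noteq> j" using s S pj by auto
      have sA: "s \<notin> A" using s assms(6) by (auto simp: A_def initials_def)
      have "{s \<in> J. cpred S s = j \<and> j \<in> initials S J} = {s}"
        using s cpred_eq_iff[OF fin] S(3) \<open>j \<in> initials S J\<close> by auto
      then have I': "initials (S - {j}) (J - {j}) = insert s A"
        using initials_delete[OF fin assms(6) S(3) Jj] by (simp add: A_def)
      have "R (insert j M) = Q (insert s M)" if M: "M \<subseteq> A" for M
      proof -
        have jM: "insert j M \<subseteq> initials S J" using M A by auto
        have jn: "j \<notin> M" and sM: "s \<notin> M" using M A sA by auto
        have jnot: "j \<notin> shift_down S J (insert j M)"
        proof
          assume "j \<in> shift_down S J (insert j M)"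
          then obtain x where x: "x \<in> J" "j = (if x \<in> insert j M then cpred S x else x)"
            by (auto simp: shift_down_def)
          then have "x \<in> insert j M" "cpred S x = j" by (auto split: if_splits)
          then show False using jM assms(6) by (auto simp: initials_def)
        qed
        \<comment> \<open>Since \<open>j\<close> has moved away and \<open>s\<close> follows it immediately in \<open>S\<close>, nothing is closer.\<close>
        have "next_elem n (shift_down S J (insert j M)) j = s"
        proof (rule next_elem_eqI)
          show "s \<in> shift_down S J (insert j M)" using s sM sS by (force simp: shift_down_def)
          show "j \<in> {1..n}" using S by auto
          fix x assume x: "x \<in> shift_down S J (insert j M)"
          then have xS: "x \<in> S" "x \<noteq> j" using shift_down_subset[OF fin S(3)] jnot by auto
          show "cyclic_dist n j s \<le> cyclic_dist n j x"
          proof (rule ccontr)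
            assume "\<not> ?thesis"
            then have "cyclic_dist n j x \<le> cyclic_dist n j j"
              using cyclic_dist_cpred(2)[OF S(1,2) sS xS(1)] s by simp
            moreover have "j \<in> {1..n}" "x \<in> {1..n}" using S xS by auto
            moreover have "cyclic_dist n j j = 0"
              using cyclic_dist_eq[of j n j] \<open>j \<in> {1..n}\<close> by simp
            ultimately have "x = j" using cyclic_dist_inj[of j n x j] by simp
            then show False using xS by simp
          qed
        qed (rule subset_n)
        then have "R (insert j M) = shift_down S (J - {s}) (insert j M - {s})"
          using shift_down_remove[OF fin S(3) jM s(1)] sM sS by (simp add: R_def)
        also have "\<dots> = insert (cpred S j) (shift_down S (J - {s} - {j}) M)"
        proof -
          have "J - {s} = insert j (J - {s} - {j})" using assms(6) sS by auto
          then have "shift_down S (J - {s}) (insert j M - {s}) =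
              (\<lambda>x. if x \<in> insert j M - {s} then cpred S x else x) ` insert j (J - {s} - {j})"
            by (simp add: shift_down_def)
          then show ?thesis using sS unfolding shift_down_def image_insert
            by (auto simp: image_def)
        qed
        also have "shift_down S (J - {s} - {j}) M = shift_down (S - {j}) (J - {s} - {j}) (insert s M)"
          unfolding shift_down_def
        proof (rule image_cong)
          fix x assume x: "x \<in> J - {s} - {j}"
          then have "cpred S x \<noteq> j" using s cpred_eq_iff[OF fin, of x s] S(3) sS by auto
          then have "cpred (S - {j}) x = cpred S x"
            using cpred_delete[OF fin S(2), of x] x S(3) by auto
          then show "(if x \<in> M then cpred S x else x) = (if x \<in> insert s M then cpred (S - {j}) x else x)"
            using x by auto
        qed simp
        also have "cpred S j = cpred (S - {j}) s"
          using cpred_delete[OF fin S(2) sS] s by simp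
        also have "insert (cpred (S - {j}) s) (shift_down (S - {j}) (J - {s} - {j}) (insert s M)) = Q (insert s M)"
        proof -
          have "J - {j} = insert s (J - {s} - {j})" using s sS by auto
          then show ?thesis unfolding Q_def shift_down_def
            by (simp only: image_insert insertI1 if_True)
        qed
        finally show ?thesis .
      qed
      then show ?thesis unfolding lhs' rhs I' alternating_sum_Pow_insert[OF A(1) sA]
        using RQ by (intro sum.cong) auto
    next
      case False
      then have I': "initials (S - {j}) (J - {j}) = A"
        using initials_delete[OF fin assms(6) S(3) Jj] by (auto simp: A_def)
      define i where "i = next_elem n (J - {j}) j"
      have "J - {j} \<subseteq> {1..n}" "J - {j} \<noteq> {}" "j \<in> {1..n}" using S Jj assms(6) by auto
      note ne = next_elem_least[OF this]
      have i: "i \<in> J" "i \<noteq> j" "\<And>x. x \<in> J - {j} \<Longrightarrow> cyclic_dist n j i \<le> cyclic_dist n j x"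
        using ne by (auto simp only: i_def)
      then have "cpred S i \<notin> J"
        using cyclic_dist_cpred(1)[OF S(1,2), of i] S(3) False by fastforce
      then have init: "i \<in> initials S J" using i by (simp add: initials_def)
      then have iA: "i \<in> A" using i by (simp add: A_def)
      have "(\<Sum>M\<in>Pow A. (-1) ^ card M * h (R (insert j M))) = 0"
      proof (rule alternating_sum_Pow_eq_0[OF A(1) iA])
        fix M assume M: "M \<subseteq> A - {i}"
        have *: "R M' = shift_down S (J - {i}) (M' - {i})" if "M' \<subseteq> initials S J" "j \<in> M'" for M'
          using shift_down_remove_next[OF S that(1) init i(2,3)] that(2) by (simp add: R_def)
        have "insert j M \<subseteq> initials S J" "insert j (insert i M) \<subseteq> initials S J"
            "insert j (insert i M) - {i} = insert j M - {i}"
          using M init A by auto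
        then show "h (R (insert j (insert i M))) = h (R (insert j M))"
          using *[of "insert j M"] *[of "insert j (insert i M)"] by simp
      qed
      then have "boundary n k L j (gapped_L_elem n L J) K = (\<Sum>M\<in>Pow A. (-1) ^ card M * h (R M))"
        unfolding lhs' by (simp add: right_diff_distrib sum_subtractf)
      then show ?thesis unfolding rhs I' using RQ by simp
    qed
  qed
qed

lemma boundary_sum:
  assumes "finite A"
  shows "boundary n k L j (\<lambda>K. \<Sum>i\<in>A. a i * f i K) = (\<lambda>K. \<Sum>i\<in>A. a i * boundary n k L j (f i) K)"
proof (cases "j \<in> L")
  case False
  then show ?thesis unfolding boundary_def
    by (simp add: sum_distrib_right sum_distrib_left mult.assoc fun_eq_iff) (subst sum.swap, simp)
qed (simp add: boundary_def)

lemma cpred_interval: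
  assumes "j \<in> {1..n}"
  shows "cpred {1..n} j = cyclic_pred n j"
  by (rule cpred_eqI) (use assms in \<open>auto simp: cyclic_pred_def\<close>)

lemma gapped_L_elem_empty:
  assumes "J \<subseteq> {1..n}"
  shows "gapped_L_elem n {} J = L_elem n J"
proof -
  have "initials {1..n} J = initial_points n J"
    using assms cpred_interval by (auto simp: initials_def initial_points_def subset_iff)
  moreover have "shift_down {1..n} J M = shifted n J M" for M
    unfolding shift_down_def shifted_def using assms cpred_interval by (intro image_cong) auto
  ultimately show ?thesis by (simp add: gapped_L_elem_def L_elem_def)
qed

lemma finite_k_subsets: "finite (k_subsets n k)"
  by (rule finite_subset[of _ "Pow {1..n}"]) (auto simp: k_subsets_def)

lemma boundary_list_blade_arrangement:
  assumes "distinct ls" "set ls \<subseteq> {1..n}" "length ls + 2 \<le> k"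
  shows "boundary_list n k ls (blade_arrangement n k c) =
    (\<lambda>K. \<Sum>J\<in>{J \<in> k_subsets n k. set ls \<subseteq> J}. c J * gapped_L_elem n (set ls) (J - set ls) K)"
  using assms
proof (induction ls)
  case Nil
  show ?case
    unfolding boundary_list.simps blade_arrangement_def
    by (intro ext sum.cong) (auto simp: gapped_L_elem_empty k_subsets_def)
next
  case (Cons j ls)
  define L where "L = set ls"
  have L: "L \<subseteq> {1..n}" "j \<in> {1..n} - L" "card L + 3 \<le> k" "finite L"
    using Cons.prems by (auto simp: L_def distinct_card)
  let ?A = "{J \<in> k_subsets n k. L \<subseteq> J}"
  have fin: "finite ?A" using finite_k_subsets by simp
  have "boundary_list n k (j # ls) (blade_arrangement n k c) =
      (\<lambda>K. \<Sum>J\<in>?A. c J * boundary n k L j (gapped_L_elem n L (J - L)) K)"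
    using Cons.IH Cons.prems boundary_sum[OF fin] by (simp add: L_def)
  also have "\<dots> = (\<lambda>K. \<Sum>J\<in>?A. if j \<in> J then c J * gapped_L_elem n (insert j L) (J - insert j L) K else 0)"
  proof (intro ext sum.cong refl)
    fix K J assume J: "J \<in> ?A"
    then have "J \<subseteq> {1..n}" "card J = k" "L \<subseteq> J" by (auto simp: k_subsets_def)
    then have J': "J - L \<subseteq> {1..n} - L" "card (J - L) + card L = k"
      using card_Diff_subset[OF L(4)] card_mono[of J L] finite_subset[of J "{1..n}"] by auto
    then have "2 \<le> card (J - L)" using L by simp
    note b = boundary_gapped_L_elem_notin[OF L(1,2) J' this] boundary_gapped_L_elem_in[OF L(1,2) J' this]
    have "J - L - {j} = J - insert j L" by auto
    then show "c J * boundary n k L j (gapped_L_elem n L (J - L)) K =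
        (if j \<in> J then c J * gapped_L_elem n (insert j L) (J - insert j L) K else 0)"
      using b L(2) by auto
  qed
  also have "\<dots> = (\<lambda>K. \<Sum>J\<in>{J \<in> ?A. j \<in> J}. c J * gapped_L_elem n (insert j L) (J - insert j L) K)"
    by (simp only: sum.inter_filter[OF fin])
  also have "{J \<in> ?A. j \<in> J} = {J \<in> k_subsets n k. set (j # ls) \<subseteq> J}"
    by (auto simp: L_def)
  finally show ?case by (simp add: L_def)
qed

lemma boundary_set_blade_arrangement:
  assumes "L \<subseteq> {1..n}" "card L + 2 \<le> k"
  shows "boundary_set n k L (blade_arrangement n k c) =
    (\<lambda>K. \<Sum>J\<in>{J \<in> k_subsets n k. L \<subseteq> J}. c J * gapped_L_elem n L (J - L) K)"
proof -
  have "finite L" using assms(1) finite_subset by blast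
  then show ?thesis unfolding boundary_set_def
    using boundary_list_blade_arrangement[of "sorted_list_of_set L" n k c] assms by simp
qed

section \<open>Coefficients of the boundaries of \<open>\<beta>(c)\<close>\<close>

definition csucc :: "nat set \<Rightarrow> nat \<Rightarrow> nat" where
  "csucc S = inv_into S (cpred S)"

definition terminals :: "nat set \<Rightarrow> nat set \<Rightarrow> nat set" where
  "terminals S I = {x \<in> I. csucc S x \<notin> I}"

definition shift_up :: "nat set \<Rightarrow> nat set \<Rightarrow> nat set \<Rightarrow> nat set" where
  "shift_up S I T = (\<lambda>x. if x \<in> T then csucc S x else x) ` I"

lemma csucc_in: "finite S \<Longrightarrow> x \<in> S \<Longrightarrow> csucc S x \<in> S"
  unfolding csucc_def by (rule inv_into_into) (simp add: cpred_surj)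

lemma cpred_csucc: "finite S \<Longrightarrow> x \<in> S \<Longrightarrow> cpred S (csucc S x) = x"
  unfolding csucc_def by (rule f_inv_into_f) (simp add: cpred_surj)

lemma csucc_cpred: "finite S \<Longrightarrow> x \<in> S \<Longrightarrow> csucc S (cpred S x) = x"
  unfolding csucc_def by (rule inv_into_f_f) (simp_all add: cpred_inj)

lemma shift_up_subset: "finite S \<Longrightarrow> I \<subseteq> S \<Longrightarrow> shift_up S I T \<subseteq> S"
  by (auto simp: shift_up_def csucc_in subset_iff)

text \<open>
  Shifting initial points back and shifting terminal points forward are inverse to each other.
  This transposes the sum that defines \<open>\<beta>(c)\<close>: instead of the sets reached from a given \<open>J\<close>, one
  runs over the sets from which a given \<open>I\<close> is reached.
\<close>

lemma shift_up_shift_down: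
  assumes "finite S" "J \<subseteq> S" "M \<subseteq> initials S J"
  shows "cpred S ` M \<subseteq> terminals S (shift_down S J M)"
    and "shift_up S (shift_down S J M) (cpred S ` M) = J"
    and "csucc S ` cpred S ` M = M"
proof -
  have M: "x \<in> J" "x \<in> S" "cpred S x \<notin> J" "csucc S (cpred S x) = x" if "x \<in> M" for x
    using that assms csucc_cpred[OF assms(1)] by (auto simp: initials_def)
  show "csucc S ` cpred S ` M = M"
    using M(4) by (auto simp: image_image)
  show "cpred S ` M \<subseteq> terminals S (shift_down S J M)"
  proof
    fix y assume "y \<in> cpred S ` M"
    then obtain x where x: "x \<in> M" "y = cpred S x" by auto
    have "x \<notin> shift_down S J M"
    proof
      assume "x \<in> shift_down S J M"
      then obtain z where "z \<in> J" "x = (if z \<in> M then cpred S z else z)"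
        by (auto simp: shift_down_def)
      then show False using M[of z] M[OF x(1)] x by (auto split: if_splits)
    qed
    moreover have "y \<in> shift_down S J M" using x M by (auto simp: shift_down_def)
    ultimately show "y \<in> terminals S (shift_down S J M)"
      using x M by (simp add: terminals_def)
  qed
  show "shift_up S (shift_down S J M) (cpred S ` M) = J"
  proof -
    let ?g = "\<lambda>y. if y \<in> cpred S ` M then csucc S y else y"
    let ?f = "\<lambda>x. if x \<in> M then cpred S x else x"
    have "?g (?f x) = x" if "x \<in> J" for x
      using that M by auto
    then have "(\<lambda>x. ?g (?f x)) ` J = (\<lambda>x. x) ` J" by (rule image_cong[OF refl])
    then show ?thesis unfolding shift_up_def shift_down_def image_image by simp
  qed
qed

lemma shift_down_shift_up:
  assumes "finite S" "I \<subseteq> S" "T \<subseteq> terminals S I"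
  shows "csucc S ` T \<subseteq> initials S (shift_up S I T)"
    and "shift_down S (shift_up S I T) (csucc S ` T) = I"
    and "cpred S ` csucc S ` T = T"
proof -
  have T: "x \<in> I" "x \<in> S" "csucc S x \<notin> I" "cpred S (csucc S x) = x" if "x \<in> T" for x
    using that assms cpred_csucc[OF assms(1)] by (auto simp: terminals_def)
  show "cpred S ` csucc S ` T = T"
    using T(4) by (auto simp: image_image)
  show "csucc S ` T \<subseteq> initials S (shift_up S I T)"
  proof
    fix y assume "y \<in> csucc S ` T"
    then obtain x where x: "x \<in> T" "y = csucc S x" by auto
    have "x \<notin> shift_up S I T"
    proof
      assume "x \<in> shift_up S I T"
      then obtain z where "z \<in> I" "x = (if z \<in> T then csucc S z else z)"
        by (auto simp: shift_up_def)
      then show False using T[of z] T[OF x(1)] x by (auto split: if_splits)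
    qed
    moreover have "y \<in> shift_up S I T" using x T by (auto simp: shift_up_def)
    ultimately show "y \<in> initials S (shift_up S I T)"
      using x T by (simp add: initials_def)
  qed
  show "shift_down S (shift_up S I T) (csucc S ` T) = I"
  proof -
    let ?g = "\<lambda>y. if y \<in> csucc S ` T then cpred S y else y"
    let ?f = "\<lambda>x. if x \<in> T then csucc S x else x"
    have "?g (?f x) = x" if "x \<in> I" for x
      using that T by auto
    then have "(\<lambda>x. ?g (?f x)) ` I = (\<lambda>x. x) ` I" by (rule image_cong[OF refl])
    then show ?thesis unfolding shift_up_def shift_down_def image_image by simp
  qed
qed

lemma card_shift_up:
  assumes "finite S" "I \<subseteq> S" "T \<subseteq> terminals S I"
  shows "card (shift_up S I T) = card I"
  using card_shift_down[OF assms(1) shift_up_subset[OF assms(1,2)] shift_down_shift_up(1)[OF assms]]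
    shift_down_shift_up(2)[OF assms] by simp

lemma sum_gapped_L_elem:
  assumes "I \<subseteq> {1..n} - L" "\<not> frozen n L I"
  shows "(\<Sum>J\<in>{J. J \<subseteq> {1..n} - L \<and> card J = card I}. c J * gapped_L_elem n L J I) =
    (\<Sum>T\<in>Pow (terminals ({1..n} - L) I). (-1) ^ card T * c (shift_up ({1..n} - L) I T))"
proof -
  define S where "S = {1..n} - L"
  have fin: "finite S" and I: "I \<subseteq> S" using assms by (auto simp: S_def)
  let ?A = "{J. J \<subseteq> S \<and> card J = card I}"
  have finA: "finite ?A" by (rule finite_subset[of _ "Pow S"]) (use fin in auto)
  have fini: "finite (Pow (initials S J))" if "J \<in> ?A" for J
    using that fin by (auto simp: initials_def finite_subset)
  let ?D = "Sigma ?A (\<lambda>J. Pow (initials S J))"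
  have finD: "finite ?D" using finA fini by (rule finite_SigmaI)
  have "(\<Sum>J\<in>?A. c J * gapped_L_elem n L J I) =
      (\<Sum>J\<in>?A. \<Sum>M\<in>Pow (initials S J). if shift_down S J M = I then (-1) ^ card M * c J else 0)"
    unfolding gapped_L_elem_def S_def[symmetric] sum_distrib_left
    using assms(2) by (intro sum.cong) (auto simp: blade_def)
  also have "\<dots> = (\<Sum>(J, M)\<in>?D. if shift_down S J M = I then (-1) ^ card M * c J else 0)"
    by (rule sum.Sigma) (use finA fini in auto)
  also have "\<dots> = (\<Sum>x\<in>{x \<in> ?D. shift_down S (fst x) (snd x) = I}. (-1) ^ card (snd x) * c (fst x))"
    by (subst sum.inter_filter[OF finD]) (auto intro!: sum.cong)
  also have "\<dots> = (\<Sum>T\<in>Pow (terminals S I). (-1) ^ card T * c (shift_up S I T))"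
  proof (rule sum.reindex_bij_witness[where j = "\<lambda>x. cpred S ` snd x"
        and i = "\<lambda>T. (shift_up S I T, csucc S ` T)"])
    fix x assume "x \<in> {x \<in> ?D. shift_down S (fst x) (snd x) = I}"
    then obtain J M where x: "x = (J, M)" "J \<subseteq> S" "M \<subseteq> initials S J" "shift_down S J M = I"
      by auto
    note ud = shift_up_shift_down[OF fin x(2,3), unfolded x(4)]
    show "(shift_up S I (cpred S ` snd x), csucc S ` cpred S ` snd x) = x"
      using x(1) ud by simp
    show "cpred S ` snd x \<in> Pow (terminals S I)" using x(1) ud by simp
    have "inj_on (cpred S) M"
      using cpred_inj[OF fin] by (rule inj_on_subset) (use x in \<open>auto simp: initials_def\<close>)
    then show "(-1) ^ card (cpred S ` snd x) * c (shift_up S I (cpred S ` snd x)) =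
        (-1) ^ card (snd x) * c (fst x)"
      using x(1) ud by (simp add: card_image)
  next
    fix T assume "T \<in> Pow (terminals S I)"
    then have T: "T \<subseteq> terminals S I" by simp
    note du = shift_down_shift_up[OF fin I T]
    show "cpred S ` snd (shift_up S I T, csucc S ` T) = T" using du by simp
    show "(shift_up S I T, csucc S ` T) \<in> {x \<in> ?D. shift_down S (fst x) (snd x) = I}"
      using du shift_up_subset[OF fin I] card_shift_up[OF fin I T] by simp
  qed
  finally show ?thesis by (simp add: S_def)
qed

lemma boundary_set_coefficient:
  assumes "L \<subseteq> {1..n}" "card L + 2 \<le> k" "I \<in> blade_index n k L"
  shows "boundary_set n k L (blade_arrangement n k c) I =
    (\<Sum>T\<in>Pow (terminals ({1..n} - L) I). (-1) ^ card T * c (L \<union> shift_up ({1..n} - L) I T))"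
proof -
  have finL: "finite L" using assms(1) finite_subset by blast
  have I: "I \<subseteq> {1..n} - L" "\<not> frozen n L I" "card I + card L = k"
    using assms(3) by (auto simp: blade_index_def)
  have "boundary_set n k L (blade_arrangement n k c) I =
      (\<Sum>J\<in>{J \<in> k_subsets n k. L \<subseteq> J}. c J * gapped_L_elem n L (J - L) I)"
    using boundary_set_blade_arrangement[OF assms(1,2)] by simp
  also have "\<dots> = (\<Sum>P\<in>{P. P \<subseteq> {1..n} - L \<and> card P = card I}. c (L \<union> P) * gapped_L_elem n L P I)"
  proof (rule sum.reindex_bij_witness[where i = "\<lambda>P. L \<union> P" and j = "\<lambda>J. J - L"])
    fix J assume J: "J \<in> {J \<in> k_subsets n k. L \<subseteq> J}"
    then have "L \<union> (J - L) = J" by auto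
    then show "L \<union> (J - L) = J" "c (L \<union> (J - L)) * gapped_L_elem n L (J - L) I =
        c J * gapped_L_elem n L (J - L) I" by simp_all
    show "J - L \<in> {P. P \<subseteq> {1..n} - L \<and> card P = card I}"
      using J I(3) card_Diff_subset[OF finL, of J] by (auto simp: k_subsets_def)
  next
    fix P assume P: "P \<in> {P. P \<subseteq> {1..n} - L \<and> card P = card I}"
    then show "L \<union> P - L = P" by auto
    have "finite P" using P by (auto intro: finite_subset)
    then have "card (L \<union> P) = card L + card P"
      using finL P by (intro card_Un_disjoint) auto
    then show "L \<union> P \<in> {J \<in> k_subsets n k. L \<subseteq> J}"
      using P I(3) assms(1) by (auto simp: k_subsets_def)
  qed
  also have "\<dots> = (\<Sum>T\<in>Pow (terminals ({1..n} - L) I). (-1) ^ card T * c (L \<union> shift_up ({1..n} - L) I T))"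
    using sum_gapped_L_elem[OF I(1,2), of "\<lambda>P. c (L \<union> P)"] .
  finally show ?thesis .
qed

section \<open>Second differences and the Pluecker relations\<close>

lemma cyc_enum_neq:
  assumes "finite S" "S \<noteq> {}" "a < b" "b < a + card S"
  shows "cyc_enum S a \<noteq> cyc_enum S b"
proof
  assume "cyc_enum S a = cyc_enum S b"
  then have "a mod card S = b mod card S" using cyc_enum_eq_iff[OF assms(1,2)] by simp
  then have "card S dvd b - a" using mod_eq_dvd_iff_nat[of a b "card S"] assms(3) by simp
  then show False using assms(3,4) by (auto dest: dvd_imp_le)
qed

lemma csucc_cyc_enum:
  assumes "finite S" "S \<noteq> {}"
  shows "csucc S (cyc_enum S i) = cyc_enum S (Suc i)"
  using csucc_cpred[OF assms(1) cyc_enum_in[OF assms, of "Suc i"]]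
  by (simp only: cpred_cyc_enum[OF assms])

lemma cyclically_ordered_4:
  "cyclically_ordered [a, b, c, d] \<longleftrightarrow>
    a < b \<and> b < c \<and> c < d \<or> b < c \<and> c < d \<and> d < a \<or>
    c < d \<and> d < a \<and> a < b \<or> d < a \<and> a < b \<and> b < c"
proof -
  have "cyclically_ordered [a, b, c, d] \<longleftrightarrow> (\<exists>r<4. sorted_wrt (<) (rotate r [a, b, c, d]))"
  proof
    assume "cyclically_ordered [a, b, c, d]"
    then obtain r where "sorted_wrt (<) (rotate r [a, b, c, d])" by (auto simp: cyclically_ordered_def)
    then have "sorted_wrt (<) (rotate (r mod 4) [a, b, c, d])"
      by (subst (asm) rotate_conv_mod) simp
    then show "\<exists>r<4. sorted_wrt (<) (rotate r [a, b, c, d])"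
      by (intro exI[of _ "r mod 4"]) simp
  qed (auto simp: cyclically_ordered_def)
  also have "\<dots> \<longleftrightarrow> a < b \<and> b < c \<and> c < d \<or> b < c \<and> c < d \<and> d < a \<or>
    c < d \<and> d < a \<and> a < b \<or> d < a \<and> a < b \<and> b < c"
  proof -
    have "(\<exists>r<4. P r) \<longleftrightarrow> P 0 \<or> P 1 \<or> P 2 \<or> P 3" for P :: "nat \<Rightarrow> bool"
      by (auto simp: numeral_eq_Suc less_Suc_eq)
    note ex = this[of "\<lambda>r. sorted_wrt (<) (rotate r [a, b, c, d])"]
    have rot: "rotate 0 [a, b, c, d] = [a, b, c, d]" "rotate 1 [a, b, c, d] = [b, c, d, a]"
      "rotate 2 [a, b, c, d] = [c, d, a, b]" "rotate 3 [a, b, c, d] = [d, a, b, c]"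
      by (simp_all add: numeral_eq_Suc)
    have sorted: "sorted_wrt (<) [x, y, z, w] \<longleftrightarrow> x < y \<and> y < z \<and> z < w" for x y z w :: nat
      by auto
    show ?thesis unfolding ex rot sorted ..
  qed
  finally show ?thesis .
qed

text \<open>
  With \<open>m\<close> the start of the round that contains \<open>p1\<close>, the map \<open>q\<close> reduces the four indices to
  one period; the later ones may wrap around, which rotates the increasing order.
\<close>

lemma cyclically_ordered_cyc_enum:
  assumes "finite S" "p1 < p2" "p2 < p3" "p3 < p4" "p4 < p1 + card S"
  shows "cyclically_ordered [cyc_enum S p1, cyc_enum S p2, cyc_enum S p3, cyc_enum S p4]"
proof -
  define N where "N = card S"
  define m where "m = N * (p1 div N)"
  have N: "0 < N" using assms by (simp add: N_def)
  have m: "m \<le> p1" "p1 < m + N" "N dvd m"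
    using N dividend_less_times_div[of N p1] by (auto simp: m_def add.commute)
  define q where "q = (\<lambda>p. if p < m + N then p - m else p - m - N)"
  have e: "cyc_enum S p = cyc_enum S (q p)" "q p < N" if "m \<le> p" "p < p1 + N" for p
  proof -
    show "q p < N" using that m by (auto simp: q_def)
    obtain u where u: "m = N * u" using m(3) by auto
    have "p mod N = q p mod N"
    proof (cases "p < m + N")
      case True
      then have "p = q p + N * u" using that u by (simp add: q_def)
      then show ?thesis by (metis mod_mult_self2)
    next
      case False
      then have "p = q p + N * (u + 1)" using that u by (simp add: q_def)
      then show ?thesis by (metis mod_mult_self2)
    qed
    then show "cyc_enum S p = cyc_enum S (q p)" using cyc_enum_mod N_def by metis
  qed
  note lt = e(2)[of p1] e(2)[of p2] e(2)[of p3] e(2)[of p4]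
  have r: "m \<le> p2" "m \<le> p3" "m \<le> p4" "p1 < p1 + N" "p2 < p1 + N" "p3 < p1 + N" "p4 < p1 + N"
    using assms m by (auto simp: N_def)
  have iff: "cyc_enum S a < cyc_enum S b \<longleftrightarrow> a < b" if "a < N" "b < N" for a b
    using cyc_enum_less_iff[OF assms(1)] that by (simp add: N_def)
  obtain a1 a2 a3 a4 where a: "p1 = m + a1" "p2 = m + a2" "p3 = m + a3" "p4 = m + a4"
    using m(1) r by (metis le_Suc_ex)
  have qa: "q (m + x) = (if x < N then x else x - N)" for x by (simp add: q_def)
  have o: "a1 < N" "a1 < a2" "a2 < a3" "a3 < a4" "a4 < a1 + N"
    using assms m by (auto simp: a N_def)
  have "cyclically_ordered [q p1, q p2, q p3, q p4]"
  proof -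
    consider "a4 < N" | "a3 < N" "N \<le> a4" | "a2 < N" "N \<le> a3" | "N \<le> a2" by linarith
    then show ?thesis
    proof cases
      case 1
      then show ?thesis unfolding cyclically_ordered_4 a qa using o by simp
    next
      case 2
      then have "a4 - N < a1" using o by linarith
      then show ?thesis unfolding cyclically_ordered_4 a qa using o 2 by simp
    next
      case 3
      then have "a4 - N < a1" "a3 - N < a4 - N" using o by linarith+
      then show ?thesis unfolding cyclically_ordered_4 a qa using o 3 by simp
    next
      case 4
      then have "a4 - N < a1" "a3 - N < a4 - N" "a2 - N < a3 - N" using o by linarith+
      then show ?thesis unfolding cyclically_ordered_4 a qa using o 4 by simp
    qed
  qed
  moreover have "q p1 < N" "q p2 < N" "q p3 < N" "q p4 < N"
    using lt m(1) r by blast+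
  ultimately show ?thesis
    unfolding e(1)[OF m(1) r(4)] e(1)[OF r(1,5)] e(1)[OF r(2,6)] e(1)[OF r(3,7)] cyclically_ordered_4
    by (simp only: iff)
qed

lemma cyclically_ordered_obtain:
  assumes "finite S" "{x1, x2, x3, x4} \<subseteq> S" "cyclically_ordered [x1, x2, x3, x4]"
  obtains p1 p2 p3 p4 where "p1 < p2" "p2 < p3" "p3 < p4" "p4 < p1 + card S"
    "x1 = cyc_enum S p1" "x2 = cyc_enum S p2" "x3 = cyc_enum S p3" "x4 = cyc_enum S p4"
proof -
  obtain q1 q2 q3 q4 where q: "q1 < card S" "x1 = cyc_enum S q1" "q2 < card S" "x2 = cyc_enum S q2"
    "q3 < card S" "x3 = cyc_enum S q3" "q4 < card S" "x4 = cyc_enum S q4"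
    using assms(1,2) cyc_enum_obtain[OF assms(1)] by (metis insert_subset)
  have iff: "cyc_enum S a < cyc_enum S b \<longleftrightarrow> a < b" if "a < card S" "b < card S" for a b
    using cyc_enum_less_iff[OF assms(1)] that by simp
  have "q1 < q2 \<and> q2 < q3 \<and> q3 < q4 \<or> q2 < q3 \<and> q3 < q4 \<and> q4 < q1 \<or>
    q3 < q4 \<and> q4 < q1 \<and> q1 < q2 \<or> q4 < q1 \<and> q1 < q2 \<and> q2 < q3"
    using assms(3) q unfolding cyclically_ordered_4 by (simp add: iff)
  then show ?thesis
  proof (elim disjE)
    assume "q1 < q2 \<and> q2 < q3 \<and> q3 < q4"
    then show ?thesis using that[of q1 q2 q3 q4] q by simp
  next
    assume "q2 < q3 \<and> q3 < q4 \<and> q4 < q1"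
    then show ?thesis using that[of q1 "q2 + card S" "q3 + card S" "q4 + card S"] q
      by (simp add: cyc_enum_add_card)
  next
    assume "q3 < q4 \<and> q4 < q1 \<and> q1 < q2"
    then show ?thesis using that[of q1 q2 "q3 + card S" "q4 + card S"] q
      by (simp add: cyc_enum_add_card)
  next
    assume "q4 < q1 \<and> q1 < q2 \<and> q2 < q3"
    then show ?thesis using that[of q1 q2 q3 "q4 + card S"] q
      by (simp add: cyc_enum_add_card)
  qed
qed

text \<open>
  A pair is nonfrozen exactly when its two points are not neighbours in either direction.
\<close>

lemma cyclic_interval_pair_iff:
  assumes "finite S" "4 \<le> card S" "p < q" "q < p + card S"
  shows "\<not> cyclic_interval S {cyc_enum S p, cyc_enum S q} \<longleftrightarrow> p + 2 \<le> q \<and> q + 2 \<le> p + card S"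
proof -
  have ne: "S \<noteq> {}" using assms(2) by auto
  let ?e = "cyc_enum S"
  have pq: "?e p \<noteq> ?e q" using cyc_enum_neq[OF assms(1) ne assms(3,4)] .
  have "?e p = ?e (Suc (p + card S - 1))" 
    using assms(2) cyc_enum_add_card[of S p] by simp
  then have cp: "cpred S (?e p) = ?e (p + card S - 1)"
    using cpred_cyc_enum[OF assms(1) ne] by simp
  have cq: "cpred S (?e q) = ?e (q - 1)"
    using cpred_cyc_enum[OF assms(1) ne, of "q - 1"] assms(3) by simp
  have "cpred S (?e p) \<noteq> ?e p" "cpred S (?e q) \<noteq> ?e q"
    using cpred_neq[OF assms(1)] cyc_enum_in[OF assms(1) ne] pq by metis+
  then have "initials S {?e p, ?e q} = {x \<in> {?e p, ?e q}. (x = ?e p \<longrightarrow> cpred S (?e p) \<noteq> ?e q) \<and>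
      (x = ?e q \<longrightarrow> cpred S (?e q) \<noteq> ?e p)}"
    using pq by (auto simp: initials_def)
  moreover have "cpred S (?e p) = ?e q \<longleftrightarrow> q + 1 = p + card S"
  proof (cases "q + 1 = p + card S")
    case True
    then have "p + card S - 1 = q" by simp
    then show ?thesis using cp True by simp
  next
    case False
    then have "?e q \<noteq> ?e (p + card S - 1)"
      using assms(2-4) by (intro cyc_enum_neq[OF assms(1) ne]) auto
    then show ?thesis using cp False by simp
  qed
  moreover have "cpred S (?e q) = ?e p \<longleftrightarrow> q = p + 1"
  proof (cases "q = p + 1")
    case False
    then have "?e p \<noteq> ?e (q - 1)"
      using assms(2-4) by (intro cyc_enum_neq[OF assms(1) ne]) auto
    then show ?thesis using cq False by simp
  qed (use cq in simp)
  ultimately have "card (initials S {?e p, ?e q}) \<le> 1 \<longleftrightarrow> q = p + 1 \<or> q + 1 = p + card S"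
    using pq by (auto simp: card_le_Suc0_iff_eq)
  moreover have "{?e p, ?e q} \<subseteq> S" using cyc_enum_in[OF assms(1) ne] by auto
  ultimately have "cyclic_interval S {?e p, ?e q} \<longleftrightarrow> q = p + 1 \<or> q + 1 = p + card S"
    using cyclic_interval_iff_initials[OF assms(1) ne] by blast
  then show ?thesis using assms(3,4) by arith
qed

definition second_difference :: "(nat \<Rightarrow> nat \<Rightarrow> real) \<Rightarrow> nat \<Rightarrow> nat \<Rightarrow> real" where
  "second_difference W p q = W p q + W (Suc p) (Suc q) - W (Suc p) q - W p (Suc q)"

lemma alternating_sum_Pow_pair:
  fixes h :: "'a set \<Rightarrow> real"
  assumes "x \<noteq> y"
  shows "(\<Sum>M\<in>Pow {x, y}. (-1) ^ card M * h M) = h {} + h {x, y} - h {x} - h {y}"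
proof -
  have "finite {y}" "x \<notin> {y}" using assms by auto
  note alternating_sum_Pow_insert[OF this, of h]
  also have "(\<Sum>M\<in>Pow {y}. (-1) ^ card M * (h M - h (insert x M))) = h {} + h {x, y} - h {x} - h {y}"
    by (simp add: Pow_insert)
  finally show ?thesis .
qed

lemma boundary_set_pair:
  assumes "L \<subseteq> {1..n}" "card L + 2 = k" "S = {1..n} - L" "4 \<le> card S"
    and "p + 2 \<le> q" "q + 2 \<le> p + card S"
  shows "{cyc_enum S p, cyc_enum S q} \<in> blade_index n k L"
    and "boundary_set n k L (blade_arrangement n k c) {cyc_enum S p, cyc_enum S q} =
      second_difference (\<lambda>a b. c (L \<union> {cyc_enum S a, cyc_enum S b})) p q"
proof -
  let ?e = "cyc_enum S"
  have fin: "finite S" using assms(3) by simp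
  have ne: "S \<noteq> {}" using assms(4) by auto
  have pq: "?e p \<noteq> ?e q" using cyc_enum_neq[OF fin ne, of p q] assms(5,6) by simp
  show idx: "{?e p, ?e q} \<in> blade_index n k L"
    using cyclic_interval_pair_iff[OF fin assms(4), of p q] assms cyc_enum_in[OF fin ne] pq
    by (auto simp: blade_index_def frozen_def)
  have s: "csucc S (?e p) = ?e (Suc p)" "csucc S (?e q) = ?e (Suc q)"
    using csucc_cyc_enum[OF fin ne] by auto
  have "?e p \<noteq> ?e (Suc p)" "?e q \<noteq> ?e (Suc q)" "?e (Suc p) \<noteq> ?e q" "?e p \<noteq> ?e (Suc q)"
    by (rule cyc_enum_neq[OF fin ne]; use assms(4-6) in simp)+
  then have t: "terminals S {?e p, ?e q} = {?e p, ?e q}"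
    by (auto simp: terminals_def s)
  show "boundary_set n k L (blade_arrangement n k c) {?e p, ?e q} =
      second_difference (\<lambda>a b. c (L \<union> {?e a, ?e b})) p q"
    using boundary_set_coefficient[OF assms(1) _ idx] assms(2) pq s
    unfolding assms(3)[symmetric] t alternating_sum_Pow_pair[OF pq]
    by (simp add: shift_up_def second_difference_def insert_commute)
qed

lemma blade_index_pairE:
  assumes "I \<in> blade_index n k L" "card L + 2 = k" "S = {1..n} - L" "4 \<le> card S"
  obtains p q where "I = {cyc_enum S p, cyc_enum S q}" "p + 2 \<le> q" "q + 2 \<le> p + card S"
proof -
  have fin: "finite S" using assms(3) by simp
  have I: "I \<subseteq> S" "card I = 2" "\<not> cyclic_interval S I"
    using assms by (auto simp: blade_index_def frozen_def)
  then obtain x y where xy: "I = {x, y}" "x < y"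
    by (metis card_2_iff insert_commute linorder_neqE_nat)
  obtain p q where pq: "p < card S" "x = cyc_enum S p" "q < card S" "y = cyc_enum S q"
    using cyc_enum_obtain[OF fin] xy I(1) by (metis insert_subset)
  then have "p < q" using xy cyc_enum_less_iff[OF fin] by simp
  then show ?thesis
    using that[of p q] cyclic_interval_pair_iff[OF fin assms(4), of p q] I(3) xy pq by simp
qed

text \<open>
  The telescoping identity behind the equivalence of the two descriptions.
\<close>

lemma sum_second_difference:
  assumes "p \<le> q" "r \<le> t"
  shows "(\<Sum>a\<in>{p..<q}. \<Sum>b\<in>{r..<t}. second_difference W a b) = W p r + W q t - W q r - W p t"
proof -
  have "(\<Sum>b\<in>{r..<t}. second_difference W a b) = (W (Suc a) t - W a t) - (W (Suc a) r - W a r)" for a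
    using sum_Suc_diff'[OF assms(2), of "\<lambda>b. W (Suc a) b - W a b"]
    by (simp add: second_difference_def algebra_simps)
  then have "(\<Sum>a\<in>{p..<q}. \<Sum>b\<in>{r..<t}. second_difference W a b) =
      (\<Sum>a\<in>{p..<q}. (W (Suc a) t - W (Suc a) r) - (W a t - W a r))"
    by (intro sum.cong refl) (simp only: algebra_simps)
  also have "\<dots> = (W q t - W q r) - (W p t - W p r)"
    by (rule sum_Suc_diff'[OF assms(1), of "\<lambda>a. W a t - W a r"])
  finally show ?thesis by simp
qed

text \<open>
  Here \<open>W a b\<close> stands for \<open>c\<close> at the pair of the points with indices \<open>a\<close> and \<open>b\<close>, unrolled
  periodically with period \<open>N\<close>.

  From left to right, each relation makes the mixed differences \<open>rect\<close> nonnegative.  A mixed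
  difference dominates the second difference at its lower corner, since the remainder splits into
  two further mixed differences.  For crossing pairs, the relation at their four points says that
  one of two mixed differences vanishes, and these have the two pairs as lower corners.

  From right to left, the two mixed differences in a relation are sums of nonnegative second
  differences over two rectangles.  If neither sum vanished, there would be a nonzero term in each,
  and the corresponding pairs would cross.
\<close>

lemma pluecker_iff_second_differences:
  fixes W :: "nat \<Rightarrow> nat \<Rightarrow> real"
  assumes sym: "\<And>a b. W a b = W b a" and per: "\<And>a b. W a (b + N) = W a b"
  shows "(\<forall>p1 p2 p3 p4. p1 < p2 \<longrightarrow> p2 < p3 \<longrightarrow> p3 < p4 \<longrightarrow> p4 < p1 + N \<longrightarrow>
        W p1 p3 + W p2 p4 = max (W p1 p2 + W p3 p4) (W p1 p4 + W p2 p3)) \<longleftrightarrow>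
    (\<forall>p q. p + 2 \<le> q \<longrightarrow> q + 2 \<le> p + N \<longrightarrow> 0 \<le> second_difference W p q) \<and>
    (\<forall>p p' q q'. p < p' \<longrightarrow> p' < q \<longrightarrow> q < q' \<longrightarrow> q' < p + N \<longrightarrow>
        second_difference W p q = 0 \<or> second_difference W p' q' = 0)"
    (is "?P \<longleftrightarrow> ?nonneg \<and> ?sep")
proof
  assume P: ?P
  define rect where "rect = (\<lambda>p q r t. W p r + W q t - W q r - W p t)"
  have rect: "0 \<le> rect p q r t" if "p \<le> q" "q < r" "r \<le> t" "t < p + N" for p q r t
  proof (cases "p = q \<or> r = t")
    case False
    then have "W p r + W q t = max (W p q + W r t) (W p t + W q r)"
      using P that by simp
    then show ?thesis by (simp add: rect_def)
  qed (auto simp: rect_def)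
  have om: "second_difference W p q = rect p (Suc p) q (Suc q)" for p q
    by (simp add: second_difference_def rect_def)
  have corner: "second_difference W p q \<le> rect p p' q q'"
    if "p < p'" "p' < q" "q < q'" "q' < p + N" for p p' q q'
  proof -
    have "rect p p' q q' = rect p (Suc p) q (Suc q) + rect (Suc p) p' q q' + rect p (Suc p) (Suc q) q'"
      by (simp add: rect_def)
    moreover have "0 \<le> rect (Suc p) p' q q'" "0 \<le> rect p (Suc p) (Suc q) q'"
      using that by (auto intro!: rect)
    ultimately show ?thesis by (simp add: om)
  qed
  have nonneg: ?nonneg by (auto simp: om intro!: rect)
  moreover have ?sep
  proof (intro allI impI)
    fix p p' q q' assume o: "p < p'" "p' < q" "q < q'" "q' < p + N"
    have "W p q + W p' q' = max (W p p' + W q q') (W p q' + W p' q)" using P o by simp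
    \<comment> \<open>The second rectangle wraps around, so its last index is \<open>p\<close> in the next period.\<close>
    moreover have "W p' (p + N) = W p p'" "W q (p + N) = W p q"
      using per sym by metis+
    ultimately have "rect p p' q q' \<le> 0 \<or> rect p' q q' (p + N) \<le> 0"
      by (auto simp: rect_def max_def sym split: if_splits)
    moreover have "second_difference W p q \<le> rect p p' q q'" using corner o by simp
    moreover have "second_difference W p' q' \<le> rect p' q q' (p + N)" using corner o by simp
    moreover have "0 \<le> second_difference W p q" "0 \<le> second_difference W p' q'"
      using nonneg o by auto
    ultimately show "second_difference W p q = 0 \<or> second_difference W p' q' = 0" by linarith
  qed
  ultimately show "?nonneg \<and> ?sep" ..
next
  assume "?nonneg \<and> ?sep"
  then have nonneg: ?nonneg and sep: ?sep by auto
  show ?P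
  proof (intro allI impI)
    fix p1 p2 p3 p4 assume o: "p1 < p2" "p2 < p3" "p3 < p4" "p4 < p1 + N"
    define A where "A = {p1..<p2} \<times> {p3..<p4}"
    define B where "B = {p2..<p3} \<times> {p4..<p1 + N}"
    let ?om = "\<lambda>(a, b). second_difference W a b"
    have sumA: "W p1 p3 + W p2 p4 - W p2 p3 - W p1 p4 = sum ?om A"
      using sum_second_difference[of p1 p2 p3 p4 W] o by (simp add: A_def sum.cartesian_product)
    have "W p2 (p1 + N) = W p1 p2" "W p3 (p1 + N) = W p1 p3"
      using per sym by metis+
    then have sumB: "W p1 p3 + W p2 p4 - W p1 p2 - W p3 p4 = sum ?om B"
      using sum_second_difference[of p2 p3 p4 "p1 + N" W] o by (simp add: B_def sum.cartesian_product)
    have posA: "0 \<le> ?om x" if "x \<in> A" for x using that nonneg o by (auto simp: A_def)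
    have posB: "0 \<le> ?om x" if "x \<in> B" for x using that nonneg o by (auto simp: B_def)
    have "sum ?om A = 0 \<or> sum ?om B = 0"
    proof (rule ccontr)
      assume "\<not> ?thesis"
      then obtain x y where xy: "x \<in> A" "?om x \<noteq> 0" "y \<in> B" "?om y \<noteq> 0"
        by (meson sum.neutral)
      obtain p q p' q' where "x = (p, q)" "y = (p', q')" by (cases x, cases y)
      with xy o have "p < p'" "p' < q" "q < q'" "q' < p + N" by (auto simp: A_def B_def)
      then have "second_difference W p q = 0 \<or> second_difference W p' q' = 0" using sep by blast
      then show False using xy \<open>x = (p, q)\<close> \<open>y = (p', q')\<close> by simp
    qed
    moreover have "0 \<le> sum ?om A" "0 \<le> sum ?om B"
      using posA posB by (auto intro!: sum_nonneg simp del: split_paired_All)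
    ultimately show "W p1 p3 + W p2 p4 = max (W p1 p2 + W p3 p4) (W p1 p4 + W p2 p3)"
      using sumA sumB by (auto simp: max_def)
  qed
qed

lemma pluecker_iff_boundary:
  assumes "L \<subseteq> {1..n}" "card L + 2 = k" "S = {1..n} - L" "4 \<le> card S"
  shows "(\<forall>j1 j2 j3 j4. {j1, j2, j3, j4} \<subseteq> S \<longrightarrow> cyclically_ordered [j1, j2, j3, j4] \<longrightarrow>
        c (L \<union> {j1, j3}) + c (L \<union> {j2, j4}) =
          max (c (L \<union> {j1, j2}) + c (L \<union> {j3, j4})) (c (L \<union> {j1, j4}) + c (L \<union> {j2, j3}))) \<longleftrightarrow>
    (\<forall>I\<in>blade_index n k L. boundary_set n k L (blade_arrangement n k c) I \<ge> 0) \<and>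
    (\<forall>I\<in>blade_index n k L. \<forall>A\<in>blade_index n k L.
       boundary_set n k L (blade_arrangement n k c) I \<noteq> 0 \<longrightarrow>
       boundary_set n k L (blade_arrangement n k c) A \<noteq> 0 \<longrightarrow> weakly_separated I A)"
    (is "?P \<longleftrightarrow> ?nonneg \<and> ?sep")
proof -
  have fin: "finite S" using assms(3) by simp
  have ne: "S \<noteq> {}" using assms(4) by auto
  let ?e = "cyc_enum S"
  define W where "W = (\<lambda>a b. c (L \<union> {?e a, ?e b}))"
  define \<omega> where "\<omega> = boundary_set n k L (blade_arrangement n k c)"
  have sym: "W a b = W b a" for a b by (simp add: W_def insert_commute)
  have per: "W a (b + card S) = W a b" for a b by (simp add: W_def cyc_enum_add_card)
  note pair = boundary_set_pair(1)[OF assms(1,2,3,4)]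
    boundary_set_pair(2)[OF assms(1,2,3,4), where c = c, folded W_def \<omega>_def]
  note pairE = blade_index_pairE[OF _ assms(2,3,4)]
  have "?P \<longleftrightarrow> (\<forall>p1 p2 p3 p4. p1 < p2 \<longrightarrow> p2 < p3 \<longrightarrow> p3 < p4 \<longrightarrow> p4 < p1 + card S \<longrightarrow>
        W p1 p3 + W p2 p4 = max (W p1 p2 + W p3 p4) (W p1 p4 + W p2 p3))"
    (is "_ \<longleftrightarrow> ?P'")
  proof
    assume P: ?P
    show ?P'
    proof (intro allI impI)
      fix p1 p2 p3 p4 assume "p1 < p2" "p2 < p3" "p3 < p4" "p4 < p1 + card S"
      note o = cyclically_ordered_cyc_enum[OF fin this]
      have sub: "{?e p1, ?e p2, ?e p3, ?e p4} \<subseteq> S" using cyc_enum_in[OF fin ne] by simp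
      show "W p1 p3 + W p2 p4 = max (W p1 p2 + W p3 p4) (W p1 p4 + W p2 p3)"
        unfolding W_def by (rule P[rule_format, OF sub o])
    qed
  next
    assume P': ?P'
    show ?P
    proof (intro allI impI)
      fix j1 j2 j3 j4 assume "{j1, j2, j3, j4} \<subseteq> S" "cyclically_ordered [j1, j2, j3, j4]"
      from cyclically_ordered_obtain[OF fin this] obtain p1 p2 p3 p4
        where p: "p1 < p2" "p2 < p3" "p3 < p4" "p4 < p1 + card S"
          and j: "j1 = ?e p1" "j2 = ?e p2" "j3 = ?e p3" "j4 = ?e p4" .
      show "c (L \<union> {j1, j3}) + c (L \<union> {j2, j4}) =
          max (c (L \<union> {j1, j2}) + c (L \<union> {j3, j4})) (c (L \<union> {j1, j4}) + c (L \<union> {j2, j3}))"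
        using P'[rule_format, OF p] unfolding W_def j .
    qed
  qed
  also have "\<dots> \<longleftrightarrow>
    (\<forall>p q. p + 2 \<le> q \<longrightarrow> q + 2 \<le> p + card S \<longrightarrow> 0 \<le> second_difference W p q) \<and>
    (\<forall>p p' q q'. p < p' \<longrightarrow> p' < q \<longrightarrow> q < q' \<longrightarrow> q' < p + card S \<longrightarrow>
        second_difference W p q = 0 \<or> second_difference W p' q' = 0)"
    by (rule pluecker_iff_second_differences[of W "card S", OF sym per])
  also have "(\<forall>p q. p + 2 \<le> q \<longrightarrow> q + 2 \<le> p + card S \<longrightarrow> 0 \<le> second_difference W p q) \<longleftrightarrow>
      (\<forall>I\<in>blade_index n k L. 0 \<le> \<omega> I)"
  proof
    assume h: "\<forall>p q. p + 2 \<le> q \<longrightarrow> q + 2 \<le> p + card S \<longrightarrow> 0 \<le> second_difference W p q"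
    show "\<forall>I\<in>blade_index n k L. 0 \<le> \<omega> I"
    proof
      fix I assume "I \<in> blade_index n k L"
      then obtain p q where "I = {?e p, ?e q}" "p + 2 \<le> q" "q + 2 \<le> p + card S" by (rule pairE)
      then show "0 \<le> \<omega> I" using h pair(2) by simp
    qed
  next
    assume h: "\<forall>I\<in>blade_index n k L. 0 \<le> \<omega> I"
    show "\<forall>p q. p + 2 \<le> q \<longrightarrow> q + 2 \<le> p + card S \<longrightarrow> 0 \<le> second_difference W p q"
      using h pair by metis
  qed
  also have "(\<forall>p p' q q'. p < p' \<longrightarrow> p' < q \<longrightarrow> q < q' \<longrightarrow> q' < p + card S \<longrightarrow>
        second_difference W p q = 0 \<or> second_difference W p' q' = 0) \<longleftrightarrow>
      (\<forall>I\<in>blade_index n k L. \<forall>A\<in>blade_index n k L. \<omega> I \<noteq> 0 \<longrightarrow> \<omega> A \<noteq> 0 \<longrightarrow> weakly_separated I A)"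
    (is "?sep1 \<longleftrightarrow> ?sep2")
  proof
    assume h: ?sep1
    show ?sep2
    proof (intro ballI impI)
      fix I A assume IA: "I \<in> blade_index n k L" "A \<in> blade_index n k L" "\<omega> I \<noteq> 0" "\<omega> A \<noteq> 0"
      show "weakly_separated I A"
        unfolding weakly_separated_def
      proof
        assume "crossing I A"
        then obtain i j a b where x: "I = {i, j}" "A = {a, b}" "cyclically_ordered [i, a, j, b]"
          by (auto simp: crossing_def)
        have "{i, a, j, b} \<subseteq> S" using IA(1,2) x(1,2) by (auto simp: blade_index_def assms(3))
        from cyclically_ordered_obtain[OF fin this x(3)] obtain p p' q q'
          where o: "p < p'" "p' < q" "q < q'" "q' < p + card S"
            and e: "i = ?e p" "a = ?e p'" "j = ?e q" "b = ?e q'" .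
        have "\<omega> I = second_difference W p q" "\<omega> A = second_difference W p' q'"
          unfolding x(1,2) e by (rule pair(2); use o in simp)+
        then show False using h[rule_format, OF o] IA(3,4) by simp
      qed
    qed
  next
    assume h: ?sep2
    show ?sep1
    proof (intro allI impI)
      fix p p' q q' assume o: "p < p'" "p' < q" "q < q'" "q' < p + card S"
      have idx: "p + 2 \<le> q" "q + 2 \<le> p + card S" "p' + 2 \<le> q'" "q' + 2 \<le> p' + card S"
        using o by auto
      have "crossing {?e p, ?e q} {?e p', ?e q'}"
        using cyclically_ordered_cyc_enum[OF fin o] unfolding crossing_def by blast
      then show "second_difference W p q = 0 \<or> second_difference W p' q' = 0"
        using h pair[OF idx(1,2)] pair[OF idx(3,4)] unfolding weakly_separated_def by metis
    qed
  qed
  finally show ?thesis unfolding \<omega>_def .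
qed

lemma gapped_L_elem_in_blade_space:
  assumes "J \<subseteq> {1..n} - L" "card J + card L = k"
  shows "gapped_L_elem n L J \<in> blade_space n k L"
proof -
  have "blade n L (shift_down ({1..n} - L) J M) K = 0"
    if K: "K \<notin> blade_index n k L" and M: "M \<subseteq> initials ({1..n} - L) J" for K M
    using K shift_down_subset[OF _ assms(1), of M] card_shift_down[OF _ assms(1) M] assms(2)
    by (auto simp: blade_def blade_index_def)
  then show ?thesis by (auto simp: blade_space_def gapped_L_elem_def intro!: sum.neutral)
qed

lemma blade_arrangement_in_blade_space: "blade_arrangement n k c \<in> blade_space n k {}"
proof -
  have "L_elem n J \<in> blade_space n k {}" if "J \<in> k_subsets n k" for J
    using gapped_L_elem_in_blade_space[of J n "{}" k] gapped_L_elem_empty[of J n] that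
    by (auto simp: k_subsets_def)
  then show ?thesis by (auto simp: blade_space_def blade_arrangement_def intro!: sum.neutral)
qed

lemma positive_pluecker_iff_Z_set:
  assumes "2 \<le> k" "k + 2 \<le> n"
  shows "positive_pluecker n k c \<longleftrightarrow> blade_arrangement n k c \<in> Z_set n k"
proof -
  have "positive_pluecker n k c \<longleftrightarrow> (\<forall>L\<in>k_subsets n (k - 2). \<forall>j1 j2 j3 j4.
        {j1, j2, j3, j4} \<subseteq> {1..n} - L \<longrightarrow> cyclically_ordered [j1, j2, j3, j4] \<longrightarrow>
        c (L \<union> {j1, j3}) + c (L \<union> {j2, j4}) =
          max (c (L \<union> {j1, j2}) + c (L \<union> {j3, j4})) (c (L \<union> {j1, j4}) + c (L \<union> {j2, j3})))"
    (is "_ \<longleftrightarrow> (\<forall>L\<in>_. ?Q L)")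
  proof
    assume P: "positive_pluecker n k c"
    show "\<forall>L\<in>k_subsets n (k - 2). ?Q L"
    proof (intro ballI allI impI)
      fix L j1 j2 j3 j4
      assume L: "L \<in> k_subsets n (k - 2)" and j: "{j1, j2, j3, j4} \<subseteq> {1..n} - L"
        and o: "cyclically_ordered [j1, j2, j3, j4]"
      have h: "{j1, j2, j3, j4} \<subseteq> {1..n}" "L \<subseteq> {1..n} - {j1, j2, j3, j4}" "card L = k - 2"
        using L j by (auto simp: k_subsets_def)
      show "c (L \<union> {j1, j3}) + c (L \<union> {j2, j4}) =
          max (c (L \<union> {j1, j2}) + c (L \<union> {j3, j4})) (c (L \<union> {j1, j4}) + c (L \<union> {j2, j3}))"
        by (rule P[unfolded positive_pluecker_def, rule_format, OF h(1) o h(2,3)])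
    qed
  next
    assume Q: "\<forall>L\<in>k_subsets n (k - 2). ?Q L"
    show "positive_pluecker n k c"
      unfolding positive_pluecker_def
    proof (intro allI impI)
      fix j1 j2 j3 j4 L
      assume j: "{j1, j2, j3, j4} \<subseteq> {1..n}" and o: "cyclically_ordered [j1, j2, j3, j4]"
        and L: "L \<subseteq> {1..n} - {j1, j2, j3, j4}" "card L = k - 2"
      have h: "L \<in> k_subsets n (k - 2)" "{j1, j2, j3, j4} \<subseteq> {1..n} - L"
        using L j by (auto simp: k_subsets_def)
      show "c (L \<union> {j1, j3}) + c (L \<union> {j2, j4}) =
          max (c (L \<union> {j1, j2}) + c (L \<union> {j3, j4})) (c (L \<union> {j1, j4}) + c (L \<union> {j2, j3}))"
        by (rule Q[rule_format, OF h o])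
    qed
  qed
  also have "\<dots> \<longleftrightarrow> blade_arrangement n k c \<in> Z_set n k"
  proof -
    let ?b = "blade_arrangement n k c"
    have "?Q L \<longleftrightarrow> (\<forall>I\<in>blade_index n k L. boundary_set n k L ?b I \<ge> 0) \<and>
       (\<forall>I\<in>blade_index n k L. \<forall>A\<in>blade_index n k L.
          boundary_set n k L ?b I \<noteq> 0 \<longrightarrow> boundary_set n k L ?b A \<noteq> 0 \<longrightarrow> weakly_separated I A)"
      if "L \<in> k_subsets n (k - 2)" for L
    proof (rule pluecker_iff_boundary)
      show L: "L \<subseteq> {1..n}" "card L + 2 = k" using that assms(1) by (auto simp: k_subsets_def)
      then show "4 \<le> card ({1..n} - L)"
        using assms(2) by (subst card_Diff_subset) (auto intro: finite_subset)
    qed simp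
    then show ?thesis
      unfolding Z_set_def using blade_arrangement_in_blade_space by simp
  qed
  finally show ?thesis .
qed

section \<open>Lattice paths\<close>

text \<open>
  The cyclic order has a single orbit.  In what follows this replaces inductions along intervals
  and gaps: a set that is closed under one step and is not everything must be empty.
\<close>

lemma csucc_closed:
  assumes "finite S" "X \<subseteq> S" "X \<noteq> {}" "\<And>x. x \<in> X \<Longrightarrow> csucc S x \<in> X"
  shows "X = S"
proof
  have ne: "S \<noteq> {}" using assms(2,3) by auto
  obtain r where r: "cyc_enum S r \<in> X"
    using assms(1-3) cyc_enum_obtain by (metis ex_in_conv subsetD)
  have *: "cyc_enum S (r + i) \<in> X" for i
  proof (induction i)
    case (Suc i)
    then show ?case using assms(4) csucc_cyc_enum[OF assms(1) ne, of "r + i"] by force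
  qed (use r in simp)
  show "S \<subseteq> X"
  proof
    fix x assume "x \<in> S"
    then obtain i where "x = cyc_enum S (r + i)" using cyc_enum_obtain_from[OF assms(1)] by metis
    then show "x \<in> X" using * by simp
  qed
qed (rule assms(2))

lemma cpred_closed:
  assumes "finite S" "X \<subseteq> S" "X \<noteq> {}" "\<And>x. x \<in> X \<Longrightarrow> cpred S x \<in> X"
  shows "X = S"
proof (rule ccontr)
  assume "X \<noteq> S"
  have "S - X = S"
  proof (rule csucc_closed[OF assms(1)])
    show "S - X \<noteq> {}" using \<open>X \<noteq> S\<close> assms(2) by auto
    fix x assume "x \<in> S - X"
    then show "csucc S x \<in> S - X"
      using assms(4)[of "csucc S x"] cpred_csucc[OF assms(1), of x] csucc_in[OF assms(1), of x] by auto
  qed auto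
  then show False using assms(2,3) by auto
qed

lemma card_terminals:
  assumes "finite S" "J \<subseteq> S"
  shows "card (terminals S J) = card (initials S J)"
proof -
  have fin: "finite J" using assms finite_subset by auto
  let ?A = "{x \<in> J. cpred S x \<in> J}" and ?B = "{x \<in> J. csucc S x \<in> J}"
  have "bij_betw (cpred S) ?A ?B"
  proof (rule bij_betw_imageI)
    show "inj_on (cpred S) ?A" using cpred_inj[OF assms(1)] by (rule inj_on_subset) (use assms in auto)
    show "cpred S ` ?A = ?B"
    proof
      show "cpred S ` ?A \<subseteq> ?B" using csucc_cpred[OF assms(1)] assms(2) by auto
      show "?B \<subseteq> cpred S ` ?A"
      proof
        fix x assume x: "x \<in> ?B"
        then have "x = cpred S (csucc S x)" using cpred_csucc[OF assms(1), of x] assms(2) by auto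
        moreover have "csucc S x \<in> ?A" using x cpred_csucc[OF assms(1), of x] assms(2) by auto
        ultimately show "x \<in> cpred S ` ?A" by (rule image_eqI)
      qed
    qed
  qed
  then have "card ?A = card ?B" by (rule bij_betw_same_card)
  moreover have "terminals S J = J - ?B" "initials S J = J - ?A"
    by (auto simp: terminals_def initials_def)
  ultimately show ?thesis using fin by (simp add: card_Diff_subset)
qed

lemma initials_nonempty:
  assumes "finite S" "J \<subseteq> S" "J \<noteq> {}" "J \<noteq> S"
  shows "initials S J \<noteq> {}"
  using cpred_closed[OF assms(1-3)] assms(4) by (auto simp: initials_def)

text \<open>
  A nonfrozen set has at least two intervals, so that one can always move a terminal point other
  than a prescribed \<open>a\<close>.  This kills every contribution to an alternating sum that depends on
  a single point.
\<close>

lemma two_terminals: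
  assumes "I \<in> blade_index n k {}"
  obtains t where "t \<in> terminals {1..n} I" "t \<noteq> a"
proof -
  have I: "I \<subseteq> {1..n}" "\<not> cyclic_interval {1..n} I"
    using assms by (auto simp: blade_index_def frozen_def)
  have "{1..n} \<noteq> {}"
  proof
    assume "{1..n} = {}"
    then have "I = set (take 0 (rotate 0 (sorted_list_of_set {1..n})))" using I by auto
    then show False using I(2) unfolding cyclic_interval_def by blast
  qed
  then have "\<not> card (terminals {1..n} I) \<le> 1"
    using cyclic_interval_iff_initials[OF _ _ I(1)] card_terminals[OF _ I(1)] I(2) by simp
  then have "\<not> terminals {1..n} I \<subseteq> {a}"
    using card_mono[of "{a}"] by auto
  then show ?thesis using that by auto
qed

definition prefix_count :: "nat set \<Rightarrow> nat \<Rightarrow> int" where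
  "prefix_count J j = int (card (J \<inter> {1..j}))"

lemma prefix_count_sum: "prefix_count J j = (\<Sum>i\<in>{1..j}. of_bool (i \<in> J))"
  by (simp add: prefix_count_def Int_commute)

lemma prefix_count_Suc: "prefix_count J (Suc j) = prefix_count J j + of_bool (Suc j \<in> J)"
  by (simp add: prefix_count_sum)

lemma prefix_count_full: "J \<subseteq> {1..n} \<Longrightarrow> prefix_count J n = int (card J)"
  by (simp add: prefix_count_def Int_absorb2)

lemma csucc_interval:
  assumes "x \<in> {1..n}"
  shows "csucc {1..n} x = (if x = n then 1 else Suc x)"
proof -
  have "x = cpred {1..n} (if x = n then 1 else Suc x)"
    using assms cpred_interval[of "if x = n then 1 else Suc x" n] by (auto simp: cyclic_pred_def)
  then show ?thesis
    using csucc_cpred[of "{1..n}" "if x = n then 1 else Suc x"] assms by auto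
qed

text \<open>
  The correction for \<open>x = 1\<close> accounts for the wrap-around, where the path restarts at \<open>0\<close>; it cancels
  in the difference of two paths with the same number of steps.
\<close>

lemma prefix_count_cpred:
  assumes "x \<in> {1..n}" "J \<subseteq> {1..n}"
  shows "prefix_count J x = prefix_count J (cpred {1..n} x) + of_bool (x \<in> J)
           - (if x = 1 then int (card J) else 0)"
proof (cases "x = 1")
  case True
  then show ?thesis
    using prefix_count_full[OF assms(2)] cpred_interval[OF assms(1)] prefix_count_Suc[of J 0]
    by (simp add: cyclic_pred_def prefix_count_def[of J 0])
next
  case False
  then obtain y where "x = Suc y" "y \<noteq> 0" using assms(1) by (cases x) auto
  then show ?thesis
    using cpred_interval[OF assms(1)] prefix_count_Suc[of J y] by (simp add: cyclic_pred_def)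
qed

lemma mem_shift_down:
  assumes "finite S" "J \<subseteq> S" "M \<subseteq> initials S J" "i \<in> S"
  shows "i \<in> shift_down S J M \<longleftrightarrow> i \<in> J \<and> i \<notin> M \<or> csucc S i \<in> M"
    and "csucc S i \<in> M \<Longrightarrow> i \<notin> J"
proof -
  have M: "x \<in> J" "x \<in> S" "cpred S x \<notin> J" "csucc S (cpred S x) = x" if "x \<in> M" for x
    using that assms csucc_cpred[OF assms(1)] by (auto simp: initials_def)
  note i = cpred_csucc[OF assms(1,4)]
  show "csucc S i \<in> M \<Longrightarrow> i \<notin> J" using M[of "csucc S i"] i by simp
  show "i \<in> shift_down S J M \<longleftrightarrow> i \<in> J \<and> i \<notin> M \<or> csucc S i \<in> M"
  proof
    assume "i \<in> shift_down S J M"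
    then obtain x where "x \<in> J" "i = (if x \<in> M then cpred S x else x)" by (auto simp: shift_down_def)
    then show "i \<in> J \<and> i \<notin> M \<or> csucc S i \<in> M" using M(4)[of x] by (auto split: if_splits)
  next
    assume "i \<in> J \<and> i \<notin> M \<or> csucc S i \<in> M"
    then show "i \<in> shift_down S J M"
    proof
      assume "csucc S i \<in> M"
      then show ?thesis using M[of "csucc S i"] i unfolding shift_down_def
        by (intro image_eqI[of _ _ "csucc S i"]) auto
    qed (auto simp: shift_down_def)
  qed
qed

text \<open>
  A shift of \<open>x\<close> back to its predecessor raises the path at that predecessor only.  If \<open>1\<close> moves back
  to \<open>n\<close>, this holds after subtracting \<open>1\<close> from the whole path.
\<close>

lemma prefix_count_shift_down:
  assumes "J \<subseteq> {1..n}" "M \<subseteq> initials {1..n} J" "j \<in> {1..n}"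
  shows "prefix_count (shift_down {1..n} J M) j =
    prefix_count J j + of_bool (csucc {1..n} j \<in> M) - of_bool (1 \<in> M)"
proof -
  have step: "of_bool (i \<in> shift_down {1..n} J M) =
      of_bool (i \<in> J) + (of_bool (csucc {1..n} i \<in> M) - of_bool (i \<in> M) :: int)" if "i \<in> {1..n}" for i
  proof -
    have "M \<subseteq> J" using assms(2) by (auto simp: initials_def)
    then show ?thesis using mem_shift_down[OF _ assms(1,2) that] by auto
  qed
  have tel: "(\<Sum>i\<in>{1..j}. of_bool (csucc {1..n} i \<in> M) - of_bool (i \<in> M)) =
      (of_bool (csucc {1..n} j \<in> M) - of_bool (1 \<in> M) :: int)" if "1 \<le> j" "j \<le> n" for j
    using that
  proof (induction j rule: dec_induct)
    case (step j)
    then have "csucc {1..n} j = Suc j" using csucc_interval[of j n] by simp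
    then show ?case using step by simp
  qed simp
  have "prefix_count (shift_down {1..n} J M) j =
      (\<Sum>i\<in>{1..j}. of_bool (i \<in> J) + (of_bool (csucc {1..n} i \<in> M) - of_bool (i \<in> M)))"
    unfolding prefix_count_sum by (rule sum.cong) (use step assms(3) in auto)
  also have "\<dots> = prefix_count J j + (of_bool (csucc {1..n} j \<in> M) - of_bool (1 \<in> M))"
    unfolding sum.distrib prefix_count_sum using tel[of j] assms(3) by simp
  finally show ?thesis by simp
qed

lemma prefix_count_shift_up:
  assumes "I \<subseteq> {1..n}" "T \<subseteq> terminals {1..n} I" "j \<in> {1..n}"
  shows "prefix_count (shift_up {1..n} I T) j = prefix_count I j + of_bool (n \<in> T) - of_bool (j \<in> T)"
proof -
  let ?S = "{1..n}"
  note du = shift_down_shift_up[OF finite_atLeastAtMost assms(1,2)]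
  have T: "T \<subseteq> ?S" using assms by (auto simp: terminals_def)
  have inj: "csucc ?S x \<in> csucc ?S ` T \<longleftrightarrow> x \<in> T" if "x \<in> ?S" for x
  proof
    assume "csucc ?S x \<in> csucc ?S ` T"
    then obtain y where "y \<in> T" "csucc ?S x = csucc ?S y" by auto
    then show "x \<in> T" using cpred_csucc[of ?S] that T by (metis finite_atLeastAtMost subsetD)
  qed simp
  have n: "n \<in> ?S" "csucc ?S n = 1" using assms(3) csucc_interval[of n n] by auto
  have "prefix_count I j = prefix_count (shift_up ?S I T) j
      + of_bool (csucc ?S j \<in> csucc ?S ` T) - of_bool (1 \<in> csucc ?S ` T)"
    using prefix_count_shift_down[OF shift_up_subset[OF _ assms(1)] du(1) assms(3)] du(2) by simp
  then show ?thesis using inj[OF assms(3)] inj[OF n(1)] n(2) by simp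
qed

text \<open>
  Lowering \<open>D\<close> by \<open>1\<close> at the points of \<open>g ` M\<close> lowers the minimum \<open>m\<close> of \<open>D\<close>, by \<open>1\<close>, exactly when
  one of these points attains \<open>m\<close>; this is where integrality enters.  If some \<open>g x\<close> does not
  attain \<open>m\<close>, then \<open>x\<close> is irrelevant and the sum vanishes.  If all of them do, only \<open>M = {}\<close> fails to
  lower the minimum, and the surplus \<open>1\<close> of that term is the value of the sum.
\<close>

lemma alternating_sum_Min:
  fixes D :: "'b \<Rightarrow> int" and g :: "'a \<Rightarrow> 'b"
  assumes "finite S" "finite X" "X \<noteq> {}" "g ` X \<subseteq> S"
  shows "(\<Sum>M\<in>Pow X. (-1) ^ card M * real_of_int (Min ((\<lambda>j. D j - of_bool (j \<in> g ` M)) ` S)))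
       = of_bool (\<forall>x\<in>X. \<forall>j\<in>S. D (g x) \<le> D j)"
proof -
  have S: "S \<noteq> {}" using assms(3,4) by auto
  define m where "m = Min (D ` S)"
  have m: "m \<le> D j" if "j \<in> S" for j using that assms(1) by (simp add: m_def)
  have "m \<in> D ` S" unfolding m_def using assms(1) S by (intro Min_in) auto
  then obtain a where a: "a \<in> S" "D a = m" by auto
  have Min: "Min ((\<lambda>j. D j - of_bool (j \<in> g ` M)) ` S) = m - of_bool (\<exists>x\<in>M. D (g x) = m)"
    if "M \<subseteq> X" for M
  proof (rule Min_eqI)
    show "finite ((\<lambda>j. D j - of_bool (j \<in> g ` M)) ` S)" using assms(1) by simp
    fix y assume "y \<in> (\<lambda>j. D j - of_bool (j \<in> g ` M)) ` S"
    then obtain j where j: "j \<in> S" "y = D j - of_bool (j \<in> g ` M)" by auto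
    show "m - of_bool (\<exists>x\<in>M. D (g x) = m) \<le> y"
    proof (cases "j \<in> g ` M \<and> \<not> (\<exists>x\<in>M. D (g x) = m)")
      case True
      then have "D j \<noteq> m" by auto
      then show ?thesis using m[OF j(1)] j(2) True by simp
    next
      case False
      then show ?thesis using m[OF j(1)] j(2) by auto
    qed
  next
    show "m - of_bool (\<exists>x\<in>M. D (g x) = m) \<in> (\<lambda>j. D j - of_bool (j \<in> g ` M)) ` S"
    proof (cases "\<exists>x\<in>M. D (g x) = m")
      case True
      then obtain x where "x \<in> M" "D (g x) = m" by auto
      then show ?thesis using that assms(4) True by (intro image_eqI[of _ _ "g x"]) auto
    next
      case False
      then have "a \<notin> g ` M" using a by auto
      then show ?thesis using False a by (intro image_eqI[of _ _ a]) auto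
    qed
  qed
  have "(\<Sum>M\<in>Pow X. (-1) ^ card M * real_of_int (Min ((\<lambda>j. D j - of_bool (j \<in> g ` M)) ` S)))
      = (\<Sum>M\<in>Pow X. (-1) ^ card M * (real_of_int m - of_bool (\<exists>x\<in>M. D (g x) = m)))"
    using Min by (intro sum.cong) auto
  also have "\<dots> = of_bool (\<forall>x\<in>X. D (g x) = m)"
  proof (cases "\<forall>x\<in>X. D (g x) = m")
    case False
    then obtain x where "x \<in> X" "D (g x) \<noteq> m" by auto
    then have "(\<Sum>M\<in>Pow X. (-1) ^ card M * (real_of_int m - of_bool (\<exists>x\<in>M. D (g x) = m))) = 0"
      by (intro alternating_sum_Pow_eq_0[OF assms(2)]) auto
    then show ?thesis using False by simp
  next
    case True
    obtain x where x: "x \<in> X" using assms(3) by auto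
    have "(\<Sum>M\<in>Pow X. (-1) ^ card M * (real_of_int m - of_bool (\<exists>x\<in>M. D (g x) = m)))
        = (\<Sum>M\<in>Pow X. (-1) ^ card M * (real_of_int m - 1)) + (\<Sum>M\<in>Pow X. if M = {} then 1 else 0)"
      unfolding sum.distrib[symmetric] using True by (intro sum.cong) (auto simp: subset_iff)
    also have "(\<Sum>M\<in>Pow X. (-1) ^ card M * (real_of_int m - 1)) = 0"
      by (intro alternating_sum_Pow_eq_0[OF assms(2) x]) auto
    also have "(\<Sum>M\<in>Pow X. if M = {} then 1 else 0) = (1::real)"
      using assms(2) by simp
    finally show ?thesis using True by simp
  qed
  also have "(\<forall>x\<in>X. D (g x) = m) \<longleftrightarrow> (\<forall>x\<in>X. \<forall>j\<in>S. D (g x) \<le> D j)"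
    using m a assms(4) by (metis image_subset_iff order_antisym)
  finally show ?thesis .
qed

text \<open>
  Let \<open>A\<close> be the set of places where the path of \<open>I\<close> is lowest relative to that of \<open>K\<close>.  Along an
  interval of \<open>I\<close> the relative height cannot decrease, so \<open>A\<close> spreads backwards from its end;
  along a gap it cannot increase, so \<open>A\<close> spreads forwards through the gap.  As \<open>A\<close> contains all
  ends of intervals, it is everything, and the two paths have the same steps.
\<close>

lemma eq_if_terminals_minimal:
  assumes "I \<subseteq> {1..n}" "K \<subseteq> {1..n}" "card I = card K" "I \<noteq> {1..n}"
    and "\<And>t j. t \<in> terminals {1..n} I \<Longrightarrow> j \<in> {1..n} \<Longrightarrow>
      prefix_count I t - prefix_count K t \<le> prefix_count I j - prefix_count K j"
  shows "I = K"
proof -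
  let ?S = "{1..n}"
  define D where "D = (\<lambda>j. prefix_count I j - prefix_count K j)"
  have S: "finite ?S" by simp
  have n: "?S \<noteq> {}" using assms(1,4) by auto
  have step: "D x = D (cpred ?S x) + of_bool (x \<in> I) - of_bool (x \<in> K)" if "x \<in> ?S" for x
    using prefix_count_cpred[OF that assms(1)] prefix_count_cpred[OF that assms(2)] assms(3)
    by (simp add: D_def)
  define A where "A = {x \<in> ?S. \<forall>j\<in>?S. D x \<le> D j}"
  have "Min (D ` ?S) \<in> D ` ?S" using n by (intro Min_in) auto
  then obtain a where "a \<in> ?S" "D a = Min (D ` ?S)" by (metis imageE)
  then have a: "a \<in> A" by (auto simp: A_def)
  have term_A: "t \<in> A" if "t \<in> terminals ?S I" for t
    using that assms(1,5) by (auto simp: A_def D_def terminals_def)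
  \<comment> \<open>Minimality propagates backwards along the elements of \<open>I\<close> and forwards along its gaps.\<close>
  have up: "cpred ?S x \<in> A" if "x \<in> A" "x \<in> I" for x
  proof -
    have x: "x \<in> ?S" "cpred ?S x \<in> ?S" using that cpred_in[OF S] by (auto simp: A_def)
    then have "D (cpred ?S x) \<le> D x" using step[OF x(1)] that(2) by (simp add: of_bool_def split: if_splits)
    then show ?thesis using that(1) x by (force simp: A_def)
  qed
  have gap: "x \<in> A" if "cpred ?S x \<in> A" "x \<in> ?S" "x \<notin> I" for x
  proof -
    have "D x \<le> D (cpred ?S x)" using step[OF that(2)] that(3) by simp
    then show ?thesis using that by (force simp: A_def)
  qed
  have "I - A = {}"
  proof (rule ccontr)
    assume "I - A \<noteq> {}"
    then have "I - A = ?S"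
    proof (rule csucc_closed[OF S, rotated])
      show "I - A \<subseteq> ?S" using assms(1) by auto
      fix x assume x: "x \<in> I - A"
      then have s: "x \<in> ?S" "cpred ?S (csucc ?S x) = x"
        using assms(1) cpred_csucc[OF S] by auto
      have "csucc ?S x \<in> I" using x term_A[of x] by (auto simp: terminals_def)
      then show "csucc ?S x \<in> I - A" using up[of "csucc ?S x"] x s by auto
    qed
    then show False using a by (auto simp: A_def)
  qed
  then have IA: "I \<subseteq> A" by auto
  have "?S - A = {}"
  proof (rule ccontr)
    assume "?S - A \<noteq> {}"
    then have "?S - A = ?S"
    proof (rule cpred_closed[OF S, rotated])
      fix x assume x: "x \<in> ?S - A"
      then have "x \<notin> I" using IA by auto
      then show "cpred ?S x \<in> ?S - A" using gap[of x] x cpred_in[OF S, of x] by auto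
    qed auto
    then show False using a by (auto simp: A_def)
  qed
  then have const: "D x = D (cpred ?S x)" if "x \<in> ?S" for x
    using that cpred_in[OF S that] by (fastforce simp: A_def intro: order_antisym)
  have "x \<in> I \<longleftrightarrow> x \<in> K" if "x \<in> ?S" for x
    using step[OF that] const[OF that] by (auto simp: of_bool_def split: if_splits)
  then show ?thesis using assms(1,2) by blast
qed

text \<open>
  For an interval \<open>K\<close> the relative height of any \<open>J\<close> falls weakly along \<open>K\<close> and rises weakly
  along its complement, so it is lowest at the end \<open>b\<close> of \<open>K\<close>.
\<close>

lemma minimal_at_unique_terminal:
  assumes "K \<subseteq> {1..n}" "J \<subseteq> {1..n}" "card J = card K" "K \<noteq> {}" "K \<noteq> {1..n}"
    and "terminals {1..n} K \<subseteq> {b}" "j \<in> {1..n}"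
  shows "prefix_count J b - prefix_count K b \<le> prefix_count J j - prefix_count K j"
proof -
  let ?S = "{1..n}"
  define D where "D = (\<lambda>j. prefix_count J j - prefix_count K j)"
  have S: "finite ?S" by simp
  have n: "?S \<noteq> {}" using assms(7) by auto
  have step: "D x = D (cpred ?S x) + of_bool (x \<in> J) - of_bool (x \<in> K)" if "x \<in> ?S" for x
    using prefix_count_cpred[OF that assms(1)] prefix_count_cpred[OF that assms(2)] assms(3)
    by (simp add: D_def)
  define A where "A = {x \<in> ?S. \<forall>j\<in>?S. D x \<le> D j}"
  have "Min (D ` ?S) \<in> D ` ?S" using n by (intro Min_in) auto
  then obtain a where "a \<in> ?S" "D a = Min (D ` ?S)" by (metis imageE)
  then have a: "a \<in> A" by (auto simp: A_def)
  have up: "x \<in> A" if "cpred ?S x \<in> A" "x \<in> K" for x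
  proof -
    have x: "x \<in> ?S" using that assms(1) by auto
    have "D x \<le> D (cpred ?S x)" using step[OF x] that(2) by simp
    then show ?thesis using that x by (force simp: A_def)
  qed
  have gap: "cpred ?S x \<in> A" if "x \<in> A" "x \<notin> K" for x
  proof -
    have x: "x \<in> ?S" "cpred ?S x \<in> ?S" using that cpred_in[OF S] by (auto simp: A_def)
    have "D (cpred ?S x) \<le> D x" using step[OF x(1)] that(2) by simp
    then show ?thesis using that x by (force simp: A_def)
  qed
  have "b \<in> A"
  proof (rule ccontr)
    assume b: "b \<notin> A"
    have "A \<inter> K = {}"
    proof (rule ccontr)
      assume "A \<inter> K \<noteq> {}"
      then have "A \<inter> K = ?S"
      proof (rule csucc_closed[OF S, rotated])
        show "A \<inter> K \<subseteq> ?S" using assms(1) by auto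
        fix x assume x: "x \<in> A \<inter> K"
        then have s: "x \<in> ?S" "cpred ?S (csucc ?S x) = x"
          using assms(1) cpred_csucc[OF S] by auto
        have "csucc ?S x \<in> K" using x b assms(6) by (auto simp: terminals_def)
        then show "csucc ?S x \<in> A \<inter> K" using up[of "csucc ?S x"] x s by auto
      qed
      then show False using assms(1,5) by auto
    qed
    then have "A = ?S"
      using a gap by (intro cpred_closed[OF S]) (auto simp: A_def)
    then show False using \<open>A \<inter> K = {}\<close> assms(1,4) by auto
  qed
  then show ?thesis using assms(7) by (auto simp: A_def D_def)
qed

section \<open>Height vectors invert \<open>c \<mapsto> \<beta>(c)\<close> modulo lineality\<close>

definition height :: "nat \<Rightarrow> nat set \<Rightarrow> nat set \<Rightarrow> int" where
  "height n K J = Min ((\<lambda>j. prefix_count J j - prefix_count K j) ` {1..n})"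

text \<open>
  The vector \<open>\<rho>\<^sub>K\<close>, an explicit preimage of the basis element \<open>\<beta>\<^sub>K\<close>.
\<close>

definition height_vector :: "nat \<Rightarrow> nat \<Rightarrow> nat set \<Rightarrow> (nat set \<Rightarrow> real)" where
  "height_vector n k K = (\<lambda>J. if J \<in> k_subsets n k then of_int (height n K J) else 0)"

lemma height_shift_up:
  assumes "I \<subseteq> {1..n}" "T \<subseteq> terminals {1..n} I" "0 < n"
  shows "height n K (shift_up {1..n} I T) =
    Min ((\<lambda>j. prefix_count I j - prefix_count K j - of_bool (j \<in> T)) ` {1..n}) + of_bool (n \<in> T)"
proof -
  have "height n K (shift_up {1..n} I T) =
    Min ((\<lambda>j. prefix_count I j - prefix_count K j - of_bool (j \<in> T) + of_bool (n \<in> T)) ` {1..n})"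
    unfolding height_def
    by (intro arg_cong[of _ _ Min] image_cong refl) (simp add: prefix_count_shift_up[OF assms(1,2)] del: One_nat_def)
  then show ?thesis using assms(3) by (simp add: Min_add_commute)
qed

lemma mem_cpred_image:
  assumes "finite S" "M \<subseteq> S" "j \<in> S"
  shows "j \<in> cpred S ` M \<longleftrightarrow> csucc S j \<in> M"
proof
  assume "j \<in> cpred S ` M"
  then show "csucc S j \<in> M" using csucc_cpred[OF assms(1)] assms(2) by auto
next
  assume "csucc S j \<in> M"
  then show "j \<in> cpred S ` M" using cpred_csucc[OF assms(1,3)] by (metis image_eqI)
qed

lemma height_shift_down:
  assumes "I \<subseteq> {1..n}" "M \<subseteq> initials {1..n} I" "0 < n"
  shows "height n (shift_down {1..n} I M) J =
    Min ((\<lambda>j. prefix_count J j - prefix_count I j - of_bool (j \<in> cpred {1..n} ` M)) ` {1..n})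
      + of_bool (1 \<in> M)"
proof -
  have "M \<subseteq> {1..n}" using assms by (auto simp: initials_def)
  then have "height n (shift_down {1..n} I M) J =
    Min ((\<lambda>j. prefix_count J j - prefix_count I j - of_bool (j \<in> cpred {1..n} ` M) + of_bool (1 \<in> M)) ` {1..n})"
    unfolding height_def
    by (intro arg_cong[of _ _ Min] image_cong refl)
      (simp add: prefix_count_shift_down[OF assms(1,2)] mem_cpred_image del: One_nat_def)
  then show ?thesis using assms(3) by (simp add: Min_add_commute)
qed

lemma sum_Pow_add:
  "(\<Sum>M\<in>Pow X. (-1) ^ card M * (a M + b M :: real)) =
   (\<Sum>M\<in>Pow X. (-1) ^ card M * a M) + (\<Sum>M\<in>Pow X. (-1) ^ card M * b M)"
  by (simp add: distrib_left sum.distrib)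

lemma blade_arrangement_coefficient:
  assumes "2 \<le> k" "I \<in> blade_index n k {}"
  shows "blade_arrangement n k c I =
    (\<Sum>T\<in>Pow (terminals {1..n} I). (-1) ^ card T * c (shift_up {1..n} I T))"
  using boundary_set_coefficient[of "{}" n k I c] assms by (simp add: boundary_set_def)

lemma shift_up_k_subsets:
  assumes "I \<in> k_subsets n k" "T \<subseteq> terminals {1..n} I"
  shows "shift_up {1..n} I T \<in> k_subsets n k"
  using assms shift_up_subset[of "{1..n}" I T] card_shift_up[of "{1..n}" I T]
  by (auto simp: k_subsets_def)

lemma blade_index_empty_subset: "blade_index n k {} \<subseteq> k_subsets n k"
  by (auto simp: blade_index_def k_subsets_def)

text \<open>
  The summand that comes from the normalisation at \<open>n\<close> depends on one point only and drops out,
  because \<open>I\<close> has another terminal point.  What remains is decided by \<open>alternating_sum_Min\<close>.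
\<close>

lemma blade_arrangement_height_vector:
  assumes "2 \<le> k" "k + 2 \<le> n" "K \<in> k_subsets n k" "I \<in> blade_index n k {}"
  shows "blade_arrangement n k (height_vector n k K) I = of_bool (I = K)"
proof -
  let ?T = "terminals {1..n} I"
  define D where "D = (\<lambda>j. prefix_count I j - prefix_count K j)"
  have I: "I \<in> k_subsets n k" using assms(4) blade_index_empty_subset by auto
  then have I': "I \<subseteq> {1..n}" "card I = k" by (auto simp: k_subsets_def)
  have K': "K \<subseteq> {1..n}" "card K = k" using assms(3) by (auto simp: k_subsets_def)
  have fin: "finite ?T" using I'(1) by (auto simp: terminals_def intro: finite_subset)
  obtain t where t: "t \<in> ?T" "t \<noteq> n" using two_terminals[OF assms(4)] .
  have "blade_arrangement n k (height_vector n k K) I =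
    (\<Sum>T\<in>Pow ?T. (-1) ^ card T * (real_of_int (Min ((\<lambda>j. D j - of_bool (j \<in> id ` T)) ` {1..n}))
       + of_bool (n \<in> T)))"
    unfolding blade_arrangement_coefficient[OF assms(1,4)]
  proof (rule sum.cong)
    fix T assume "T \<in> Pow ?T"
    then have T: "T \<subseteq> ?T" by simp
    show "(-1) ^ card T * height_vector n k K (shift_up {1..n} I T) =
      (-1) ^ card T * (real_of_int (Min ((\<lambda>j. D j - of_bool (j \<in> id ` T)) ` {1..n})) + of_bool (n \<in> T))"
      using height_shift_up[OF I'(1) T] shift_up_k_subsets[OF I T] assms(2)
      by (simp add: height_vector_def D_def)
  qed simp
  also have "\<dots> = of_bool (\<forall>t\<in>?T. \<forall>j\<in>{1..n}. D (id t) \<le> D j)"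
  proof -
    have "(\<Sum>T\<in>Pow ?T. (-1) ^ card T * (of_bool (n \<in> T) :: real)) = 0"
      using t by (intro alternating_sum_Pow_eq_0[OF fin t(1)]) auto
    moreover have "?T \<noteq> {}" using t by auto
    moreover have "id ` ?T \<subseteq> {1..n}" using I'(1) by (auto simp: terminals_def)
    ultimately show ?thesis
      unfolding sum_Pow_add using alternating_sum_Min[OF _ fin, of "{1..n}" id D] by simp
  qed
  also have "(\<forall>t\<in>?T. \<forall>j\<in>{1..n}. D (id t) \<le> D j) \<longleftrightarrow> I = K"
  proof
    assume min: "\<forall>t\<in>?T. \<forall>j\<in>{1..n}. D (id t) \<le> D j"
    show "I = K"
    proof (rule eq_if_terminals_minimal[OF I'(1) K'(1)])
      show "I \<noteq> {1..n}" using I'(2) assms(2) by auto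
    qed (use min I' K' in \<open>auto simp: D_def\<close>)
  qed (simp add: D_def)
  finally show ?thesis .
qed

lemma blade_arrangement_sum:
  "blade_arrangement n k (\<lambda>J. \<Sum>K\<in>B. f K * g K J) I = (\<Sum>K\<in>B. f K * blade_arrangement n k (g K) I)"
  unfolding blade_arrangement_def sum_distrib_right sum_distrib_left
  by (subst sum.swap) (simp add: mult.assoc)

lemma finite_blade_index_empty: "finite (blade_index n k {})"
  using finite_subset[OF blade_index_empty_subset finite_k_subsets] .

lemma blade_arrangement_right_inverse:
  assumes "2 \<le> k" "k + 2 \<le> n" "f \<in> blade_space n k {}"
  shows "blade_arrangement n k (\<lambda>J. \<Sum>K\<in>blade_index n k {}. f K * height_vector n k K J) = f"
proof
  fix I
  show "blade_arrangement n k (\<lambda>J. \<Sum>K\<in>blade_index n k {}. f K * height_vector n k K J) I = f I"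
  proof (cases "I \<in> blade_index n k {}")
    case True
    have "(\<Sum>K\<in>blade_index n k {}. f K * blade_arrangement n k (height_vector n k K) I) =
        (\<Sum>K\<in>blade_index n k {}. if I = K then f K else 0)"
    proof (rule sum.cong)
      fix K assume "K \<in> blade_index n k {}"
      then have "K \<in> k_subsets n k" using blade_index_empty_subset by blast
      then show "f K * blade_arrangement n k (height_vector n k K) I = (if I = K then f K else 0)"
        using blade_arrangement_height_vector[OF assms(1,2) _ True] by simp
    qed simp
    then show ?thesis using True finite_blade_index_empty by (simp add: blade_arrangement_sum)
  next
    case False
    then show ?thesis
      using blade_arrangement_in_blade_space assms(3) unfolding blade_space_def by fastforce
  qed
qed

text \<open>
  The form in which the lineality space is used: functions on \<open>k\<close>-subsets that are additive in the
  elements.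
\<close>

lemma lineality_iff:
  "v \<in> lineality n k \<longleftrightarrow> (\<exists>t. v = (\<lambda>J. if J \<in> k_subsets n k then \<Sum>a\<in>J. t a else 0))"
proof -
  have "(\<Sum>a\<in>{1..n}. t a * lineality_gen n k a J) = (if J \<in> k_subsets n k then \<Sum>a\<in>J. t a else 0)"
    for t J
  proof (cases "J \<in> k_subsets n k")
    case True
    then have "{1..n} \<inter> J = J" by (auto simp: k_subsets_def)
    then have "(\<Sum>a\<in>J. t a) = (\<Sum>a\<in>{1..n}. if a \<in> J then t a else 0)"
      using sum.inter_restrict[of "{1..n}" t J] by simp
    then show ?thesis using True by (auto simp: lineality_gen_def intro!: sum.cong)
  qed (simp add: lineality_gen_def)
  then show ?thesis by (simp add: lineality_def)
qed

lemma lineality_sum: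
  assumes "\<And>i. i \<in> A \<Longrightarrow> f i \<in> lineality n k"
  shows "(\<lambda>J. \<Sum>i\<in>A. r i * f i J) \<in> lineality n k"
proof -
  obtain t where t: "\<And>i. i \<in> A \<Longrightarrow> f i = (\<lambda>J. if J \<in> k_subsets n k then \<Sum>a\<in>J. t i a else 0)"
    using assms unfolding lineality_iff by metis
  have "(\<Sum>i\<in>A. r i * f i J) = (if J \<in> k_subsets n k then \<Sum>a\<in>J. \<Sum>i\<in>A. r i * t i a else 0)" for J
    using t by (subst sum.swap) (simp add: sum_distrib_left)
  then show ?thesis unfolding lineality_iff by (intro exI[of _ "\<lambda>a. \<Sum>i\<in>A. r i * t i a"]) auto
qed

lemma lineality_lincomb:
  assumes "u \<in> lineality n k" "v \<in> lineality n k"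
  shows "(\<lambda>J. a * u J + b * v J) \<in> lineality n k"
  using lineality_sum[of "{False, True}" "\<lambda>i. if i then u else v" n k "\<lambda>i. if i then a else b"] assms
  by (simp add: add.commute)

lemma lineality_prefix_count:
  "(\<lambda>J. if J \<in> k_subsets n k then of_int (prefix_count J b) else 0) \<in> lineality n k"
proof -
  have "real_of_int (prefix_count J b) = (\<Sum>a\<in>J. of_bool (a \<in> {1..b}))" if "J \<in> k_subsets n k" for J
  proof -
    have "finite J" using that by (auto simp: k_subsets_def intro: finite_subset)
    moreover have "J \<inter> {a. a \<in> {1..b}} = J \<inter> {1..b}" by auto
    ultimately show ?thesis by (simp add: prefix_count_def del: atLeastAtMost_iff)
  qed
  then show ?thesis unfolding lineality_iff
    by (intro exI[of _ "\<lambda>a. of_bool (a \<in> {1..b})"]) auto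
qed

text \<open>
  All the sets have \<open>k\<close> elements, so a constant can be spread evenly over them.
\<close>

lemma lineality_const:
  assumes "0 < k"
  shows "(\<lambda>J. if J \<in> k_subsets n k then r else 0) \<in> lineality n k"
  unfolding lineality_iff
  by (rule exI[of _ "\<lambda>_. r / real k"]) (use assms in \<open>auto simp: k_subsets_def fun_eq_iff\<close>)

lemma height_vector_frozen:
  assumes "0 < k" "k < n" "K \<in> k_subsets n k" "frozen n {} K"
  shows "height_vector n k K \<in> lineality n k"
proof -
  let ?S = "{1..n}"
  have K: "K \<subseteq> ?S" "card K = k" "K \<noteq> {}" "K \<noteq> ?S" "?S \<noteq> {}"
    using assms by (auto simp: k_subsets_def)
  have "card (terminals ?S K) \<le> 1"
    using assms(4) cyclic_interval_iff_initials[OF _ K(5,1)] card_terminals[OF _ K(1)]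
    by (simp add: frozen_def)
  moreover have "terminals ?S K \<noteq> {}"
    using csucc_closed[OF _ K(1,3)] K(4) by (auto simp: terminals_def)
  moreover have "finite (terminals ?S K)" using K(1) by (auto simp: terminals_def intro: finite_subset)
  ultimately have "card (terminals ?S K) = 1" by (metis card_0_eq le_less less_one)
  then obtain b where b: "terminals ?S K = {b}" by (auto simp: card_1_singleton_iff)
  then have bS: "b \<in> ?S" using K(1) by (auto simp: terminals_def)
  have "height n K J = prefix_count J b - prefix_count K b" if "J \<in> k_subsets n k" for J
    unfolding height_def
  proof (rule Min_eqI)
    fix y assume "y \<in> (\<lambda>j. prefix_count J j - prefix_count K j) ` ?S"
    then obtain j where "j \<in> ?S" "y = prefix_count J j - prefix_count K j" by blast
    then show "prefix_count J b - prefix_count K b \<le> y"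
      using minimal_at_unique_terminal[OF K(1) _ _ K(3,4), of J b j] b that K(2)
      by (auto simp: k_subsets_def)
  qed (use bS in auto)
  then have "height_vector n k K = (\<lambda>J. 1 * (if J \<in> k_subsets n k then of_int (prefix_count J b) else 0)
      + (-1) * (if J \<in> k_subsets n k then of_int (prefix_count K b) else 0))"
    by (auto simp: height_vector_def)
  also have "\<dots> \<in> lineality n k"
    by (intro lineality_lincomb lineality_prefix_count lineality_const assms(1))
  finally show ?thesis .
qed

lemma complement_prefix_count:
  assumes "J \<subseteq> {1..n}" "j \<in> {1..n}"
  shows "prefix_count ({1..n} - J) j = int j - prefix_count J j"
proof -
  have "({1..n} - J) \<inter> {1..j} = {1..j} - (J \<inter> {1..j})" using assms(2) by auto
  moreover have "card (J \<inter> {1..j}) \<le> card {1..j}" by (rule card_mono) auto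
  ultimately show ?thesis by (simp add: prefix_count_def card_Diff_subset)
qed

text \<open>
  Passing to complements exchanges moving points forward and moving points back, which reduces the
  mirror image of \<open>eq_if_terminals_minimal\<close> to that lemma itself.
\<close>

lemma terminals_complement:
  assumes "finite S" "J \<subseteq> S"
  shows "terminals S (S - J) = cpred S ` initials S J"
proof -
  have "x \<in> terminals S (S - J) \<longleftrightarrow> x \<in> cpred S ` initials S J" if "x \<in> S" for x
    using mem_cpred_image[OF assms(1) _ that, of "initials S J"] that assms(2)
      csucc_in[OF assms(1) that] cpred_csucc[OF assms(1) that]
    by (auto simp: terminals_def initials_def subset_iff)
  moreover have "terminals S (S - J) \<subseteq> S" "cpred S ` initials S J \<subseteq> S"
    using cpred_in[OF assms(1)] assms(2) by (auto simp: terminals_def initials_def)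
  ultimately show ?thesis by blast
qed

text \<open>
  Now the set that defines the height moves, and the argument stays fixed.  The sum \<open>r\<close> of the
  normalisation terms need not vanish, since \<open>I\<close> may have a single initial point; it does not
  depend on \<open>J\<close>, which is enough modulo lineality.
\<close>

lemma alternating_sum_height_vector:
  assumes "0 < k" "k < n" "I \<in> k_subsets n k"
  obtains r where "\<And>J. J \<in> k_subsets n k \<Longrightarrow>
    (\<Sum>M\<in>Pow (initials {1..n} I). (-1) ^ card M * height_vector n k (shift_down {1..n} I M) J)
      = of_bool (I = J) + r"
proof
  let ?S = "{1..n}"
  let ?X = "initials ?S I"
  let ?r = "\<Sum>M\<in>Pow ?X. (-1) ^ card M * (of_bool (1 \<in> M) :: real)"
  fix J assume J: "J \<in> k_subsets n k"
  define D where "D = (\<lambda>j. prefix_count J j - prefix_count I j)"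
  have I': "I \<subseteq> ?S" "card I = k" "I \<noteq> {}" "I \<noteq> ?S" using assms by (auto simp: k_subsets_def)
  have J': "J \<subseteq> ?S" "card J = k" using J by (auto simp: k_subsets_def)
  have fin: "finite ?X" using I'(1) by (auto simp: initials_def intro: finite_subset)
  have ne: "?X \<noteq> {}" using initials_nonempty[OF _ I'(1,3,4)] by simp
  have "(\<Sum>M\<in>Pow ?X. (-1) ^ card M * height_vector n k (shift_down ?S I M) J) =
    (\<Sum>M\<in>Pow ?X. (-1) ^ card M * (real_of_int (Min ((\<lambda>j. D j - of_bool (j \<in> cpred ?S ` M)) ` ?S))
      + of_bool (1 \<in> M)))"
    using J assms(2)
    by (intro sum.cong) (auto simp: height_vector_def height_shift_down[OF I'(1)] D_def simp del: One_nat_def)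
  also have "\<dots> = of_bool (\<forall>x\<in>?X. \<forall>j\<in>?S. D (cpred ?S x) \<le> D j) + ?r"
  proof -
    have "cpred ?S ` ?X \<subseteq> ?S" using cpred_in[of ?S] I'(1) by (auto simp: initials_def subset_iff)
    then show ?thesis unfolding sum_Pow_add using alternating_sum_Min[OF _ fin ne, of ?S "cpred ?S" D] by simp
  qed
  also have "(\<forall>x\<in>?X. \<forall>j\<in>?S. D (cpred ?S x) \<le> D j) \<longleftrightarrow> I = J"
  proof
    assume min: "\<forall>x\<in>?X. \<forall>j\<in>?S. D (cpred ?S x) \<le> D j"
    \<comment> \<open>The complement of \<open>I\<close> has its terminal points just before the initial points of \<open>I\<close>.\<close>
    have "?S - I = ?S - J"
    proof (rule eq_if_terminals_minimal)
      show "card (?S - I) = card (?S - J)"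
        using I' J' by (simp add: card_Diff_subset finite_subset)
      show "?S - I \<noteq> ?S" using I'(1,3) by auto
      fix t j assume t: "t \<in> terminals ?S (?S - I)" and j: "j \<in> ?S"
      then have tS: "t \<in> ?S" by (auto simp: terminals_def)
      have "t \<in> cpred ?S ` ?X" using t terminals_complement[OF _ I'(1)] by simp
      then have "D t \<le> D j" using min j by auto
      then show "prefix_count (?S - I) t - prefix_count (?S - J) t
          \<le> prefix_count (?S - I) j - prefix_count (?S - J) j"
        using I'(1) J'(1) tS j by (simp add: complement_prefix_count D_def del: One_nat_def)
    qed auto
    then show "I = J" using I'(1) J'(1) by blast
  qed (simp add: D_def)
  finally show "(\<Sum>M\<in>Pow ?X. (-1) ^ card M * height_vector n k (shift_down ?S I M) J)
      = of_bool (I = J) + ?r" .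
qed

text \<open>
  Expanding \<open>\<L>\<^sub>I\<close> leaves out its frozen terms.  Restoring them changes the sum by height vectors of
  frozen sets, which lie in the lineality space.
\<close>

lemma L_elem_left_inverse:
  assumes "0 < k" "k < n" "I \<in> k_subsets n k"
  shows "(\<lambda>J. of_bool (J = I) - (\<Sum>K\<in>blade_index n k {}. L_elem n I K * height_vector n k K J))
    \<in> lineality n k"
proof -
  let ?S = "{1..n}"
  let ?X = "initials ?S I"
  have I: "I \<subseteq> ?S" "card I = k" using assms(3) by (auto simp: k_subsets_def)
  obtain r where r: "\<And>J. J \<in> k_subsets n k \<Longrightarrow>
    (\<Sum>M\<in>Pow ?X. (-1) ^ card M * height_vector n k (shift_down ?S I M) J) = of_bool (I = J) + r"
    using alternating_sum_height_vector[OF assms] by blast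
  define g where "g = (\<lambda>M. if frozen n {} (shift_down ?S I M)
     then height_vector n k (shift_down ?S I M) else (\<lambda>_. 0))"
  have ks: "shift_down ?S I M \<in> k_subsets n k" if "M \<subseteq> ?X" for M
    using shift_down_subset[of ?S I M] card_shift_down[of ?S I M] that I by (auto simp: k_subsets_def)
  have zero: "(\<lambda>_. 0) \<in> lineality n k"
    using lineality_sum[of "{}" _ n k] by simp
  have g: "g M \<in> lineality n k" if "M \<in> Pow ?X" for M
    using height_vector_frozen[OF assms(1,2)] ks that zero by (auto simp: g_def)
  have "of_bool (J = I) - (\<Sum>K\<in>blade_index n k {}. L_elem n I K * height_vector n k K J) =
      (-1) * (if J \<in> k_subsets n k then r else 0) + 1 * (\<Sum>M\<in>Pow ?X. (-1) ^ card M * g M J)" for J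
  proof -
    have "(\<Sum>K\<in>blade_index n k {}. L_elem n I K * height_vector n k K J) =
        (\<Sum>K\<in>blade_index n k {}. \<Sum>M\<in>Pow ?X. (-1) ^ card M * (blade n {} (shift_down ?S I M) K * height_vector n k K J))"
      unfolding gapped_L_elem_empty[OF I(1), symmetric] gapped_L_elem_def
      by (simp add: sum_distrib_right mult.assoc)
    also have "\<dots> = (\<Sum>M\<in>Pow ?X. (-1) ^ card M *
        (\<Sum>K\<in>blade_index n k {}. blade n {} (shift_down ?S I M) K * height_vector n k K J))"
      by (subst sum.swap) (simp add: sum_distrib_left)
    also have "\<dots> = (\<Sum>M\<in>Pow ?X. (-1) ^ card M * (height_vector n k (shift_down ?S I M) J + - g M J))"
    proof (rule sum.cong)
      fix M assume "M \<in> Pow ?X"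
      then have "shift_down ?S I M \<in> k_subsets n k" using ks by simp
      then have "shift_down ?S I M \<subseteq> ?S - {}" "card (shift_down ?S I M) + card ({} :: nat set) = k"
        by (auto simp: k_subsets_def)
      note sum_blade[OF this, of "\<lambda>K. height_vector n k K J"]
      then show "(-1) ^ card M * (\<Sum>K\<in>blade_index n k {}. blade n {} (shift_down ?S I M) K * height_vector n k K J)
        = (-1) ^ card M * (height_vector n k (shift_down ?S I M) J + - g M J)"
        by (simp add: g_def)
    qed simp
    also have "\<dots> = (\<Sum>M\<in>Pow ?X. (-1) ^ card M * height_vector n k (shift_down ?S I M) J)
        - (\<Sum>M\<in>Pow ?X. (-1) ^ card M * g M J)"
      unfolding sum_Pow_add by (simp add: sum_negf)
    also have "(\<Sum>M\<in>Pow ?X. (-1) ^ card M * height_vector n k (shift_down ?S I M) J) =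
        of_bool (J = I) + (if J \<in> k_subsets n k then r else 0)"
      using r assms(3) by (auto simp: height_vector_def)
    finally show ?thesis by simp
  qed
  moreover have "(\<lambda>J. (-1) * (if J \<in> k_subsets n k then r else 0)
      + 1 * (\<Sum>M\<in>Pow ?X. (-1) ^ card M * g M J)) \<in> lineality n k"
    by (rule lineality_lincomb[OF lineality_const[OF assms(1)] lineality_sum[OF g]])
  ultimately show ?thesis by (simp only:)
qed

lemma blade_arrangement_left_inverse:
  assumes "0 < k" "k < n" "c \<in> pluecker_space n k"
  shows "(\<lambda>J. c J - (\<Sum>K\<in>blade_index n k {}. blade_arrangement n k c K * height_vector n k K J))
    \<in> lineality n k"
proof -
  have "c J - (\<Sum>K\<in>blade_index n k {}. blade_arrangement n k c K * height_vector n k K J) =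
    (\<Sum>I\<in>k_subsets n k. c I * (of_bool (J = I) - (\<Sum>K\<in>blade_index n k {}. L_elem n I K * height_vector n k K J)))" for J
  proof -
    have "c J = (\<Sum>I\<in>k_subsets n k. if J = I then c I else 0)"
      using assms(3) finite_k_subsets[of n k] by (simp add: pluecker_space_def)
    also have "\<dots> = (\<Sum>I\<in>k_subsets n k. c I * of_bool (J = I))"
      by (intro sum.cong) auto
    finally have "c J = (\<Sum>I\<in>k_subsets n k. c I * of_bool (J = I))" .
    moreover have "(\<Sum>K\<in>blade_index n k {}. blade_arrangement n k c K * height_vector n k K J) =
        (\<Sum>I\<in>k_subsets n k. c I * (\<Sum>K\<in>blade_index n k {}. L_elem n I K * height_vector n k K J))"
      unfolding blade_arrangement_def sum_distrib_right sum_distrib_left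
      by (subst sum.swap) (simp add: mult.assoc)
    ultimately show ?thesis by (simp only: right_diff_distrib sum_subtractf)
  qed
  then show ?thesis by (simp only: lineality_sum[OF L_elem_left_inverse[OF assms(1,2)]])
qed

text \<open>
  Whether \<open>a\<close> belongs to a shifted \<open>I\<close> depends on a single terminal point \<open>s\<close>: on \<open>a\<close> itself if
  \<open>a \<in> I\<close>, and otherwise on its predecessor.  A terminal point other than \<open>s\<close> makes the alternating
  sum vanish.
\<close>

lemma blade_arrangement_lineality:
  assumes "2 \<le> k" "v \<in> lineality n k"
  shows "blade_arrangement n k v = (\<lambda>_. 0)"
proof
  fix I
  have S: "finite {1..n}" by simp
  show "blade_arrangement n k v I = 0"
  proof (cases "I \<in> blade_index n k {}")
    case True
    then have I: "I \<in> k_subsets n k" using blade_index_empty_subset by auto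
    then have I': "I \<subseteq> {1..n}" by (auto simp: k_subsets_def)
    have fin: "finite (terminals {1..n} I)" using I' by (auto simp: terminals_def intro: finite_subset)
    have gen: "blade_arrangement n k (lineality_gen n k a) I = 0" if a: "a \<in> {1..n}" for a
    proof -
      define s where "s = (if a \<in> I then a else cpred {1..n} a)"
      obtain t where t: "t \<in> terminals {1..n} I" "t \<noteq> s" using two_terminals[OF True] .
      have tS: "t \<in> {1..n}" using t I' by (auto simp: terminals_def)
      have mem: "a \<in> shift_up {1..n} I T \<longleftrightarrow> (if a \<in> I then a \<notin> T else cpred {1..n} a \<in> T)"
        if T: "T \<subseteq> terminals {1..n} I" for T
      proof
        assume "a \<in> shift_up {1..n} I T"
        then obtain x where x: "x \<in> I" "a = (if x \<in> T then csucc {1..n} x else x)"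
          by (auto simp: shift_up_def)
        then show "if a \<in> I then a \<notin> T else cpred {1..n} a \<in> T"
          using T cpred_csucc[OF S, of x] I' by (auto simp: terminals_def split: if_splits)
      next
        assume h: "if a \<in> I then a \<notin> T else cpred {1..n} a \<in> T"
        show "a \<in> shift_up {1..n} I T"
        proof (cases "a \<in> I")
          case True
          then show ?thesis using h by (auto simp: shift_up_def)
        next
          case False
          then have "cpred {1..n} a \<in> I" "a = csucc {1..n} (cpred {1..n} a)" "cpred {1..n} a \<in> T"
            using h T csucc_cpred[OF S a] by (auto simp: terminals_def)
          then show ?thesis unfolding shift_up_def by (intro image_eqI[of _ _ "cpred {1..n} a"]) auto
        qed
      qed
      show ?thesis unfolding blade_arrangement_coefficient[OF assms(1) True]
      proof (rule alternating_sum_Pow_eq_0[OF fin t(1)])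
        fix T assume T: "T \<subseteq> terminals {1..n} I - {t}"
        then have T': "T \<subseteq> terminals {1..n} I" "insert t T \<subseteq> terminals {1..n} I" using t by auto
        have "a \<in> shift_up {1..n} I (insert t T) \<longleftrightarrow> a \<in> shift_up {1..n} I T"
          unfolding mem[OF T'(1)] mem[OF T'(2)] using t(2) by (auto simp: s_def split: if_splits)
        then show "lineality_gen n k a (shift_up {1..n} I (insert t T)) = lineality_gen n k a (shift_up {1..n} I T)"
          using shift_up_k_subsets[OF I T'(1)] shift_up_k_subsets[OF I T'(2)] by (simp add: lineality_gen_def)
      qed
    qed
    obtain t where "v = (\<lambda>J. \<Sum>a\<in>{1..n}. t a * lineality_gen n k a J)"
      using assms(2) by (auto simp: lineality_def)
    then show ?thesis using gen by (simp add: blade_arrangement_sum)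
  next
    case False
    then show ?thesis using blade_arrangement_in_blade_space by (auto simp: blade_space_def)
  qed
qed

section \<open>The bijection modulo lineality\<close>

lemma blade_arrangement_diff:
  "blade_arrangement n k (\<lambda>J. c J - d J) = (\<lambda>K. blade_arrangement n k c K - blade_arrangement n k d K)"
  by (simp add: blade_arrangement_def left_diff_distrib sum_subtractf)

lemma blade_arrangement_eq_iff:
  assumes "2 \<le> k" "k + 2 \<le> n" "c \<in> pluecker_space n k" "d \<in> pluecker_space n k"
  shows "blade_arrangement n k c = blade_arrangement n k d \<longleftrightarrow> (\<lambda>J. c J - d J) \<in> lineality n k"
proof
  assume eq: "blade_arrangement n k c = blade_arrangement n k d"
  have k: "0 < k" "k < n" using assms(1,2) by auto
  from lineality_lincomb[OF blade_arrangement_left_inverse[OF k assms(3)]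
      blade_arrangement_left_inverse[OF k assms(4)], of 1 "-1"]
  show "(\<lambda>J. c J - d J) \<in> lineality n k" by (simp add: eq)
next
  assume "(\<lambda>J. c J - d J) \<in> lineality n k"
  from blade_arrangement_lineality[OF assms(1) this]
  show "blade_arrangement n k c = blade_arrangement n k d"
    unfolding blade_arrangement_diff by (simp add: fun_eq_iff)
qed

lemma mem_lineality_class:
  assumes "2 \<le> k" "k + 2 \<le> n" "c \<in> pluecker_space n k"
  shows "d \<in> lineality_class n k c \<longleftrightarrow>
    d \<in> pluecker_space n k \<and> blade_arrangement n k d = blade_arrangement n k c"
proof -
  have "blade_arrangement n k d = blade_arrangement n k c \<longleftrightarrow> (\<lambda>J. c J - d J) \<in> lineality n k"
    if "d \<in> pluecker_space n k"
    using blade_arrangement_eq_iff[OF assms that] by auto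
  then show ?thesis using assms(3) by (auto simp: lineality_class_def lineality_rel_def)
qed

theorem lemma4p14:
  fixes n k :: nat
  assumes "2 \<le> k" and "k + 2 \<le> n"
  shows "(\<forall>c\<in>pluecker_space n k. positive_pluecker n k c \<longleftrightarrow> blade_arrangement n k c \<in> Z_set n k) \<and>
         (\<exists>\<Phi>. (\<forall>c\<in>pluecker_space n k. \<Phi> (lineality_class n k c) = blade_arrangement n k c) \<and>
               bij_betw \<Phi> (lineality_class n k ` trop_plus n k) (Z_set n k))"
proof (intro conjI ballI exI)
  fix c
  show "positive_pluecker n k c \<longleftrightarrow> blade_arrangement n k c \<in> Z_set n k"
    using positive_pluecker_iff_Z_set[OF assms] .
next
  let ?\<Phi> = "\<lambda>C. blade_arrangement n k (SOME c. c \<in> C)"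
  have \<Phi>: "?\<Phi> (lineality_class n k c) = blade_arrangement n k c" if "c \<in> pluecker_space n k" for c
  proof -
    have "c \<in> lineality_class n k c" using mem_lineality_class[OF assms that] that by simp
    then have "(SOME d. d \<in> lineality_class n k c) \<in> lineality_class n k c"
      by (metis some_in_eq empty_iff)
    then show ?thesis using mem_lineality_class[OF assms that] by simp
  qed
  then show "?\<Phi> (lineality_class n k c) = blade_arrangement n k c" if "c \<in> pluecker_space n k" for c
    using that .
  show "bij_betw ?\<Phi> (lineality_class n k ` trop_plus n k) (Z_set n k)"
  proof (rule bij_betw_imageI)
    have trop: "c \<in> pluecker_space n k" if "c \<in> trop_plus n k" for c
      using that by (simp add: trop_plus_def)
    show "inj_on ?\<Phi> (lineality_class n k ` trop_plus n k)"
    proof (rule inj_onI)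
      fix C D assume "C \<in> lineality_class n k ` trop_plus n k" "D \<in> lineality_class n k ` trop_plus n k"
        and eq: "?\<Phi> C = ?\<Phi> D"
      then obtain c d where cd: "c \<in> pluecker_space n k" "d \<in> pluecker_space n k"
        "C = lineality_class n k c" "D = lineality_class n k d"
        using trop by blast
      then have "blade_arrangement n k c = blade_arrangement n k d" using eq \<Phi> by simp
      then show "C = D" using mem_lineality_class[OF assms cd(1)] mem_lineality_class[OF assms cd(2)]
        unfolding cd(3,4) by auto
    qed
    show "?\<Phi> ` lineality_class n k ` trop_plus n k = Z_set n k"
    proof
      show "?\<Phi> ` lineality_class n k ` trop_plus n k \<subseteq> Z_set n k"
      proof
        fix f assume "f \<in> ?\<Phi> ` lineality_class n k ` trop_plus n k"
        then obtain c where c: "c \<in> trop_plus n k" "f = ?\<Phi> (lineality_class n k c)" by blast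
        then have "f = blade_arrangement n k c" using \<Phi>[OF trop] by simp
        then show "f \<in> Z_set n k"
          using c(1) positive_pluecker_iff_Z_set[OF assms] by (simp add: trop_plus_def)
      qed
      show "Z_set n k \<subseteq> ?\<Phi> ` lineality_class n k ` trop_plus n k"
      proof
        fix f assume f: "f \<in> Z_set n k"
        define c where "c = (\<lambda>J. \<Sum>K\<in>blade_index n k {}. f K * height_vector n k K J)"
        have "c \<in> pluecker_space n k"
          by (auto simp: c_def pluecker_space_def height_vector_def)
        moreover have b: "blade_arrangement n k c = f"
          unfolding c_def using f by (intro blade_arrangement_right_inverse[OF assms]) (simp add: Z_set_def)
        ultimately have "c \<in> trop_plus n k"
          using f positive_pluecker_iff_Z_set[OF assms, of c] by (simp add: trop_plus_def)
        then show "f \<in> ?\<Phi> ` lineality_class n k ` trop_plus n k"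
          using \<Phi>[OF trop] b by (metis image_eqI)
      qed
    qed
  qed
qed

end
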